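(* Let $n\ge 1$ be an integer, and set $a_n=\cos\frac{\pi}{2(2n+1)}$ and $b_n=\sin\frac{\pi}{2(2n+1)}$. The solution $u_{2n+1}(x,t)$ to the Cauchy problem $$\frac{\partial u}{\partial t}=(-1)^n\frac{\partial^{2n+1}u}{\partial x^{2n+1}},\quad x\in\mathbb{R},\ t>0,\qquad u(x,0)=\delta(x),$$ is given by $$u_{2n+1}(x,t)=\frac{1}{\pi x}\,E\left[e^{-b_n x\,G^{2n+1}(1/t)}\,\sin\left(a_n x\,G^{2n+1}(1/t)\right)\right],\qquad x\in\mathbb{R},\ t>0,$$ where $G^{\gamma}(t)$ denotes, for $\gamma>0$ and $t>0$, a positive random variable with the generalized gamma density $$g^{\gamma}(x,t)=\gamma\,\frac{x^{\gamma-1}}{t}\exp\left(-\frac{x^{\gamma}}{t}\right),\quad x>0.$$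
   Context: Here $\delta$ is the Dirac delta at $0$ and $E$ denotes expectation. In $G^{2n+1}(1/t)$ the superscript $2n+1$ is the parameter $\gamma$ of the distribution, not a power. "The solution" means the fundamental solution, i.e. the function with Fourier transform $\int_{\mathbb{R}}e^{i\beta x}u_{2n+1}(x,t)\,dx=e^{-it\beta^{2n+1}}$; equivalently $u_{2n+1}(x,t)=\frac{1}{2\pi}\int_{\mathbb{R}}e^{-i\beta x-it\beta^{2n+1}}\,d\beta$ (a conditionally convergent oscillatory integral). At $x=0$ the right-hand side of the representation is understood as its limit as $x\to0$. *)

theory Defs
  imports "HOL-Probability.Probability"
begin

definition gen_gamma_density :: "real \<Rightarrow> real \<Rightarrow> real \<Rightarrow> real" where
  "gen_gamma_density \<gamma> t x =
     (if x > 0 then \<gamma> * (x powr (\<gamma> - 1) / t) * exp (- (x powr \<gamma> / t)) else 0)"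

(* The argument order is u x t throughout; only t > 0 is constrained.
   deriv is a total operator, so the existence of the x-derivatives is required explicitly. *)
definition solves_pde :: "nat \<Rightarrow> (real \<Rightarrow> real \<Rightarrow> real) \<Rightarrow> bool" where
  "solves_pde n u \<longleftrightarrow> (\<forall>t>0. \<forall>x.
     (\<forall>k<2*n+1. (deriv ^^ k) (\<lambda>y. u y t) differentiable (at x)) \<and>
     ((\<lambda>s. u x s) has_real_derivative
        (-1) ^ n * (deriv ^^ (2*n+1)) (\<lambda>y. u y t) x) (at t))"

definition test_function :: "(real \<Rightarrow> real) \<Rightarrow> bool" where
  "test_function \<phi> \<longleftrightarrow>
     (\<forall>k x. (deriv ^^ k) \<phi> differentiable (at x)) \<and> bounded {x. \<phi> x \<noteq> 0}"

(* u(x,0) = delta(x) as convergence of distributions for t \<rightarrow> 0+ *)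
definition initial_delta :: "(real \<Rightarrow> real \<Rightarrow> real) \<Rightarrow> bool" where
  "initial_delta u \<longleftrightarrow> (\<forall>\<phi>. test_function \<phi> \<longrightarrow>
     ((\<lambda>t. \<integral>x. u x t * \<phi> x \<partial>lborel) \<longlongrightarrow> \<phi> 0) (at_right 0))"

(* Inverse Fourier transform of exp (-i t \<beta>^(2n+1)). The integrand has modulus 1/(2 pi), so
   this is not a Lebesgue integral; the gauge integral over UNIV is the limit of the
   integrals over [A,B] as A \<rightarrow> -\<infinity> and B \<rightarrow> \<infinity> independently, i.e. the conditionally
   convergent integral. Its convergence is part of the condition. *)
definition inverse_fourier_symbol :: "nat \<Rightarrow> (real \<Rightarrow> real \<Rightarrow> real) \<Rightarrow> bool" where
  "inverse_fourier_symbol n u \<longleftrightarrow> (\<forall>t>0. \<forall>x.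
     ((\<lambda>\<beta>::real. exp (- \<i> * of_real (\<beta> * x) - \<i> * of_real (t * \<beta> ^ (2*n+1))) / (2 * of_real pi))
        has_integral complex_of_real (u x t)) UNIV)"

(* The equation and the initial datum alone do not single out one function; the last
   conjunct does. *)
definition fundamental_solution :: "nat \<Rightarrow> (real \<Rightarrow> real \<Rightarrow> real) \<Rightarrow> bool" where
  "fundamental_solution n u \<longleftrightarrow>
     solves_pde n u \<and> initial_delta u \<and> inverse_fourier_symbol n u"

end

theory Submission
  imports Defs "HOL-Complex_Analysis.Cauchy_Integral_Theorem" "HOL-Real_Asymp.Real_Asymp"
begin

text \<open>
  Let $N = 2n+1$ and $w = e^{i\pi/(2N)}$, so that $w^N = i$. Rotating the contour of the oscillatory
  integral of $e^{i(\beta x + t\beta^N)}$ over $[0,\infty)$ to the ray through $w$ turns it into the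
  absolutely convergent integral $w \int_0^\infty e^{ixwy - ty^N}\,dy$, and $1/\pi$ times its real
  part is the inverse Fourier transform. On the ray one may differentiate under the integral
  sign, which gives the equation, and integrate by parts, which gives the expectation over the
  generalized gamma density. For the initial datum, testing the solution against $\phi$ amounts to
  integrating $e^{it\beta^N}$ against the (integrable) Fourier transform of $\phi$; letting $t \to 0$
  leaves Fourier inversion at the origin, which follows from the limit of the sine integral.
\<close>

section \<open>Moments along the rotated ray\<close>

text \<open>The obstacle is that the defining integrand has constant modulus, so neither
  differentiation under the integral nor an exchange with integration against a test function can be
  justified directly. Rotation removes the first difficulty: \<open>w^N = i\<close> makes
  \<open>i t z^N\<close> real and negative on the ray, and since \<open>N\<close> \<ge> 2 this decay
  beats \<open>exp(i x w y)\<close>, which grows when \<open>x < 0\<close>. The second is met by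
  truncating to \<open>[-R,R]\<close>, where Fubini applies, and letting \<open>R\<close> tend to
  infinity with an estimate of the closing arc that is uniform for bounded \<open>x\<close>.

  The constants of the theorem are the real and imaginary parts of \<open>w\<close>. The prefactor
  \<open>1/x\<close> comes from the integration by parts: \<open>N t y^(N-1) exp(- t y^N)\<close> is
  the generalized gamma density with parameter \<open>1/t\<close>, its integral against
  \<open>exp(i x w y)\<close> is \<open>1 + i x w m\<close> with \<open>m\<close> the ray integral
  of \<open>exp(i x w y - t y^N)\<close>, and the imaginary part discards the 1.\<close>

lemma has_field_derivative_integral_dominated:
  fixes f :: "'a::{real_normed_field,banach,second_countable_topology} \<Rightarrow> 'b \<Rightarrow> 'a"
  assumes T: "open T" "convex T" "x0 \<in> T"
    and int: "\<And>x. x \<in> T \<Longrightarrow> integrable M (f x)"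
    and deriv: "\<And>x y. x \<in> T \<Longrightarrow> ((\<lambda>x. f x y) has_field_derivative f' x y) (at x)"
    and meas: "f' x0 \<in> borel_measurable M"
    and bound: "\<And>x y. x \<in> T \<Longrightarrow> norm (f' x y) \<le> g y"
    and g: "integrable M g"
  shows "((\<lambda>x. \<integral>y. f x y \<partial>M) has_field_derivative (\<integral>y. f' x0 y \<partial>M)) (at x0)"
  unfolding has_field_derivative_iff tendsto_at_iff_sequentially comp_def
proof (intro allI impI)
  fix X :: "nat \<Rightarrow> 'a"
  assume X: "\<forall>i. X i \<in> UNIV - {x0}" and lim: "X \<longlonglongrightarrow> x0"
  have "eventually (\<lambda>i. X i \<in> T) sequentially"
    using topological_tendstoD[OF lim] T by blast
  \<comment> \<open>An initial segment of the sequence may lie outside \<open>T\<close>; the shift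
    by \<open>K\<close> puts every index under the hypotheses.\<close>
  then obtain K where K: "\<And>i. i \<ge> K \<Longrightarrow> X i \<in> T"
    by (auto simp: eventually_sequentially)
  let ?q = "\<lambda>i y. (f (X (i + K)) y - f x0 y) / (X (i + K) - x0)"
  have "(\<lambda>i. \<integral>y. ?q i y \<partial>M) \<longlonglongrightarrow> (\<integral>y. f' x0 y \<partial>M)"
  proof (rule integral_dominated_convergence[where w = g])
    show "?q i \<in> borel_measurable M" for i
      using int[OF K[of "i + K"]] int[OF T(3)] by (auto simp: divide_inverse)
    show "AE y in M. (\<lambda>i. ?q i y) \<longlonglongrightarrow> f' x0 y"
    proof (rule AE_I2)
      fix y
      have "(\<lambda>i. X (i + K)) \<longlonglongrightarrow> x0"
        by (rule LIMSEQ_ignore_initial_segment[OF lim])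
      moreover have "((\<lambda>x. (f x y - f x0 y) / (x - x0)) \<longlongrightarrow> f' x0 y) (at x0)"
        using deriv[OF T(3)] by (simp add: has_field_derivative_iff)
      ultimately show "(\<lambda>i. ?q i y) \<longlonglongrightarrow> f' x0 y"
        using X unfolding tendsto_at_iff_sequentially comp_def
        by (auto dest!: spec[where x = "\<lambda>i. X (i + K)"])
    qed
    show "AE y in M. norm (?q i y) \<le> g y" for i
    proof (rule AE_I2)
      fix y
      \<comment> \<open>Mean value inequality on the convex set \<open>T\<close>: the bound on the
        derivative becomes a bound on the difference quotient that does not depend on the
        index.\<close>
      have "norm (f (X (i + K)) y - f x0 y) \<le> g y * norm (X (i + K) - x0)"
        using T K[of "i + K"] bound
        by (intro field_differentiable_bound[OF T(2), where f' = "\<lambda>x. f' x y"])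
           (auto intro: has_field_derivative_at_within[OF deriv])
      then show "norm (?q i y) \<le> g y"
        using X by (simp add: norm_divide pos_divide_le_eq)
    qed
  qed (use g meas in auto)
  moreover have "(\<integral>y. ?q i y \<partial>M) =
      ((\<integral>y. f (X (i + K)) y \<partial>M) - (\<integral>y. f x0 y \<partial>M)) / (X (i + K) - x0)" for i
    using int[OF K[of "i + K"]] int[OF T(3)] by simp
  ultimately have "(\<lambda>i. ((\<integral>y. f (X (i + K)) y \<partial>M) - (\<integral>y. f x0 y \<partial>M)) / (X (i + K) - x0))
      \<longlonglongrightarrow> (\<integral>y. f' x0 y \<partial>M)"
    by (simp only:)
  then show "(\<lambda>i. ((\<integral>y. f (X i) y \<partial>M) - (\<integral>y. f x0 y \<partial>M)) / (X i - x0))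
      \<longlonglongrightarrow> (\<integral>y. f' x0 y \<partial>M)"
    by (rule LIMSEQ_offset)
qed

text \<open>Among the \<open>N\<close>-th roots of \<open>i\<close> this is the one nearest the
  positive axis, so Im z^N stays nonnegative in the sector swept by the rotation. For
  \<open>N = 2n+1\<close> its real and imaginary parts are the constants \<open>a\<close> and
  \<open>b\<close> of the theorem.\<close>

definition ray_direction :: "nat \<Rightarrow> complex" where
  "ray_direction N = cis (pi / (2 * real N))"

text \<open>The power \<open>y^k\<close> closes the family under differentiation: d/dz contributes
  the factor \<open>i w y\<close> and d/dt the factor \<open>- y^N\<close>. Both parameters are
  complex so that field derivatives are available; real values are inserted later.\<close>

definition ray_integrand :: "nat \<Rightarrow> nat \<Rightarrow> complex \<Rightarrow> complex \<Rightarrow> real \<Rightarrow> complex" where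
  "ray_integrand N k z t y =
     of_real y ^ k * exp (\<i> * z * ray_direction N * of_real y - t * of_real y ^ N)"

definition ray_moment :: "nat \<Rightarrow> nat \<Rightarrow> complex \<Rightarrow> complex \<Rightarrow> complex" where
  "ray_moment N k z t = (\<integral>y. indicator {0..} y *\<^sub>R ray_integrand N k z t y \<partial>lborel)"

lemma norm_ray_direction [simp]: "norm (ray_direction N) = 1"
  by (simp add: ray_direction_def)

lemma ray_direction_power: "N > 0 \<Longrightarrow> ray_direction N ^ N = \<i>"
  by (simp add: ray_direction_def Complex.DeMoivre)

lemma integrable_power_times_exp_Ici:
  "integrable lborel (\<lambda>y::real. indicator {0..} y * (y ^ k * exp (- y)))"
proof (rule integrableI_nonneg)
  have "(\<integral>\<^sup>+y. ennreal (indicator {0..} y * (y ^ k * exp (- y))) \<partial>lborel) =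
        (\<integral>\<^sup>+y. ennreal (y ^ k * exp (- y)) * indicator {0..} y \<partial>lborel)"
    by (intro nn_integral_cong) (auto split: split_indicator)
  then show "(\<integral>\<^sup>+y. ennreal (indicator {0..} y * (y ^ k * exp (- y))) \<partial>lborel) < \<infinity>"
    by (simp add: nn_intergal_power_times_exp_Ici)
qed (auto split: split_indicator)

text \<open>The aim is an integrable tail \<open>exp (- y)\<close>. Replacing \<open>y^N\<close> by
  \<open>y^2 - 1\<close> leaves a quadratic at the cost of the summand \<tau>. The linear
  coefficient is \<open>X + 1\<close> because one \<open>y\<close> is set aside for the tail, and
  completing the square yields the remaining constant.\<close>

lemma exponent_bound:
  fixes y :: real
  assumes "N \<ge> 2" "y \<ge> 0" "\<tau> > 0"
  shows "X * y - \<tau> * y ^ N \<le> (X + 1)\<^sup>2 / (4 * \<tau>) + \<tau> - y"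
proof -
  have "y\<^sup>2 - 1 \<le> y ^ N"
  proof (cases "y \<ge> 1")
    case True
    then have "y ^ 2 \<le> y ^ N" using assms by (intro power_increasing) auto
    then show ?thesis by simp
  next
    case False
    then have "y\<^sup>2 \<le> 1" using assms by (simp add: power_le_one)
    moreover have "y ^ N \<ge> 0" using assms by simp
    ultimately show ?thesis by linarith
  qed
  then have "\<tau> * (y\<^sup>2 - 1) \<le> \<tau> * y ^ N" using assms by simp
  moreover have "(X + 1) * y - \<tau> * y\<^sup>2 \<le> (X + 1)\<^sup>2 / (4 * \<tau>)"
  proof -
    have "0 \<le> (2 * \<tau> * y - (X + 1))\<^sup>2" by simp
    then show ?thesis using assms by (simp add: field_simps power2_eq_square)
  qed
  ultimately show ?thesis by (simp add: algebra_simps)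
qed

text \<open>The crude estimate |exp (i z w y)| \<le> exp (|z| y) suffices, since
  \<open>exponent_bound\<close> absorbs any linear growth. The majorant depends on \<open>z\<close>
  and \<open>t\<close> only through \<open>X\<close> and \<tau>, which is the local uniformity
  required for differentiating under the integral sign.\<close>

lemma norm_ray_integrand_le:
  assumes "N \<ge> 2" "y \<ge> 0" "\<tau> > 0" "norm z \<le> X" "Re t \<ge> \<tau>"
  shows "norm (ray_integrand N k z t y) \<le> exp ((X + 1)\<^sup>2 / (4 * \<tau>) + \<tau>) * (y ^ k * exp (- y))"
proof -
  have "Re (\<i> * z * ray_direction N * of_real y) \<le> norm (\<i> * z * ray_direction N * of_real y)"
    by (rule complex_Re_le_cmod)
  also have "\<dots> \<le> X * y"
    using assms by (simp add: norm_mult mult_right_mono)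
  finally have 1: "Re (\<i> * z * ray_direction N * of_real y) \<le> X * y" .
  have "Re (t * of_real y ^ N) = Re t * y ^ N"
    by (metis Re_complex_of_real complex_scaleR mult.commute of_real_power scaleR_complex.sel(1)
        scaleR_conv_of_real)
  moreover have "\<tau> * y ^ N \<le> Re t * y ^ N"
    using assms by (intro mult_right_mono) auto
  ultimately have "Re (\<i> * z * ray_direction N * of_real y - t * of_real y ^ N)
      \<le> (X + 1)\<^sup>2 / (4 * \<tau>) + \<tau> - y"
    using 1 exponent_bound[of N y \<tau> X] assms by simp
  then have "norm (exp (\<i> * z * ray_direction N * of_real y - t * of_real y ^ N))
      \<le> exp ((X + 1)\<^sup>2 / (4 * \<tau>) + \<tau> - y)"
    by simp
  also have "\<dots> = exp ((X + 1)\<^sup>2 / (4 * \<tau>) + \<tau>) * exp (- y)"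
    by (simp flip: exp_add)
  finally have "norm (exp (\<i> * z * ray_direction N * of_real y - t * of_real y ^ N))
      \<le> exp ((X + 1)\<^sup>2 / (4 * \<tau>) + \<tau>) * exp (- y)" .
  then have "y ^ k * norm (exp (\<i> * z * ray_direction N * of_real y - t * of_real y ^ N))
      \<le> y ^ k * (exp ((X + 1)\<^sup>2 / (4 * \<tau>) + \<tau>) * exp (- y))"
    using assms by (intro mult_left_mono) auto
  then show ?thesis
    using assms by (simp add: ray_integrand_def norm_mult norm_power mult_ac del: norm_exp_eq_Re)
qed

lemma norm_indicator_ray_integrand_le:
  assumes "N \<ge> 2" "\<tau> > 0" "norm z \<le> X" "Re t \<ge> \<tau>"
  shows "norm (indicator {0..} y *\<^sub>R ray_integrand N k z t y)
    \<le> exp ((X + 1)\<^sup>2 / (4 * \<tau>) + \<tau>) * (indicator {0..} y * (y ^ k * exp (- y)))"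
  using norm_ray_integrand_le[of N y \<tau> z X t k] assms by (simp split: split_indicator)

lemma ray_integrand_measurable [measurable]: "ray_integrand N k z t \<in> borel_measurable borel"
  unfolding ray_integrand_def by measurable

lemma integrable_ray_integrand:
  assumes "N \<ge> 2" "Re t > 0"
  shows "integrable lborel (\<lambda>y. indicator {0..} y *\<^sub>R ray_integrand N k z t y)"
  by (rule Bochner_Integration.integrable_bound
      [where f = "\<lambda>y. exp ((norm z + 1)\<^sup>2 / (4 * Re t) + Re t) * (indicator {0..} y * (y ^ k * exp (- y)))"])
     (use norm_indicator_ray_integrand_le[OF assms order_refl order_refl, where z = z]
       in \<open>auto intro!: integrable_power_times_exp_Ici AE_I2 order_trans[OF _ abs_ge_self] simp del: norm_scaleR\<close>)

lemma ray_moment_has_field_derivative_x: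
  assumes N: "N \<ge> 2" and t: "Re t > 0"
  shows "((\<lambda>z. ray_moment N k z t) has_field_derivative
           \<i> * ray_direction N * ray_moment N (Suc k) z t) (at z)"
proof -
  let ?w = "ray_direction N"
  \<comment> \<open>One \<open>+ 1\<close> is the radius of the ball around \<open>z\<close>; the
    other is the one in \<open>exponent_bound\<close>.\<close>
  let ?C = "exp ((norm z + 1 + 1)\<^sup>2 / (4 * Re t) + Re t)"
  have "((\<lambda>z. \<integral>y. indicator {0..} y *\<^sub>R ray_integrand N k z t y \<partial>lborel) has_field_derivative
      (\<integral>y. \<i> * ?w * (indicator {0..} y *\<^sub>R ray_integrand N (Suc k) z t y) \<partial>lborel)) (at z)"
  proof (rule has_field_derivative_integral_dominated[where T = "ball z 1"
        and f' = "\<lambda>z y. \<i> * ?w * (indicator {0..} y *\<^sub>R ray_integrand N (Suc k) z t y)"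
        and g = "\<lambda>y. ?C * (indicator {0..} y * (y ^ Suc k * exp (- y)))"])
    show "integrable lborel (\<lambda>y. ?C * (indicator {0..} y * (y ^ Suc k * exp (- y))))"
      by (intro integrable_mult_right integrable_power_times_exp_Ici)
    fix v y assume "v \<in> ball z 1"
    then have v: "norm v \<le> norm z + 1"
      using norm_triangle_ineq2[of v z] by (simp add: dist_norm norm_minus_commute)
    show "norm (\<i> * ?w * (indicator {0..} y *\<^sub>R ray_integrand N (Suc k) v t y))
        \<le> ?C * (indicator {0..} y * (y ^ Suc k * exp (- y)))"
      using norm_indicator_ray_integrand_le[OF N t v order_refl, where y = y and k = "Suc k"]
      by (simp add: norm_mult)
    show "((\<lambda>v. indicator {0..} y *\<^sub>R ray_integrand N k v t y) has_field_derivative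
        \<i> * ?w * (indicator {0..} y *\<^sub>R ray_integrand N (Suc k) v t y)) (at v)"
      unfolding ray_integrand_def scaleR_conv_of_real
      by (auto intro!: derivative_eq_intros simp: algebra_simps)
  qed (use N t in \<open>auto intro!: integrable_ray_integrand\<close>)
  then show ?thesis by (simp add: ray_moment_def del: mult_scaleR_right)
qed

lemma ray_moment_has_field_derivative_t:
  assumes N: "N \<ge> 2" and t: "Re t > 0"
  shows "((\<lambda>t. ray_moment N k z t) has_field_derivative - ray_moment N (k + N) z t) (at t)"
proof -
  let ?C = "exp ((norm z + 1)\<^sup>2 / (4 * (Re t / 2)) + Re t / 2)"
  have "((\<lambda>t. \<integral>y. indicator {0..} y *\<^sub>R ray_integrand N k z t y \<partial>lborel) has_field_derivative
      (\<integral>y. - (indicator {0..} y *\<^sub>R ray_integrand N (k + N) z t y) \<partial>lborel)) (at t)"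
  \<comment> \<open>On this half-plane the real part of the time parameter stays above
    \<open>Re t / 2\<close>, which takes the place of \<tau> in the majorant.\<close>
  proof (rule has_field_derivative_integral_dominated[where T = "{s. Re s > Re t / 2}"
        and f' = "\<lambda>t y. - (indicator {0..} y *\<^sub>R ray_integrand N (k + N) z t y)"
        and g = "\<lambda>y. ?C * (indicator {0..} y * (y ^ (k + N) * exp (- y)))"])
    show "integrable lborel (\<lambda>y. ?C * (indicator {0..} y * (y ^ (k + N) * exp (- y))))"
      by (intro integrable_mult_right integrable_power_times_exp_Ici)
    show "open {s. Re s > Re t / 2}" by (rule open_halfspace_Re_gt)
    show "convex {s. Re s > Re t / 2}" by (rule convex_halfspace_Re_gt)
    fix v y assume "v \<in> {s. Re s > Re t / 2}"
    then have v: "Re t / 2 \<le> Re v" by simp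
    show "norm (- (indicator {0..} y *\<^sub>R ray_integrand N (k + N) z v y))
        \<le> ?C * (indicator {0..} y * (y ^ (k + N) * exp (- y)))"
      using norm_indicator_ray_integrand_le[OF N _ order_refl v, where z = z and y = y and k = "k + N"] t
      by simp
    show "((\<lambda>v. indicator {0..} y *\<^sub>R ray_integrand N k z v y) has_field_derivative
        - (indicator {0..} y *\<^sub>R ray_integrand N (k + N) z v y)) (at v)"
      unfolding ray_integrand_def scaleR_conv_of_real
      by (auto intro!: derivative_eq_intros simp: algebra_simps power_add)
  qed (use N t in \<open>auto intro!: integrable_ray_integrand\<close>)
  then show ?thesis by (simp add: ray_moment_def)
qed

text \<open>The two half lines contribute complex conjugates, hence twice a real part; with the
  prefactor 1/(2 pi) of the inverse transform this leaves Re / pi.\<close>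

definition ray_solution :: "nat \<Rightarrow> real \<Rightarrow> real \<Rightarrow> real" where
  "ray_solution N x t = Re (ray_direction N * ray_moment N 0 (of_real x) (of_real t)) / pi"

text \<open>Each x-derivative brings down \<open>i w\<close> and raises the moment by one; on the
  real axis taking real parts commutes with differentiation. The second claim with
  \<open>k = 0\<close> also supplies the continuity in \<open>x\<close> used later.\<close>

lemma deriv_power_ray_solution:
  assumes N: "N \<ge> 2" and t: "t > 0"
  shows "(deriv ^^ k) (\<lambda>y. ray_solution N y t) = (\<lambda>x.
      Re (ray_direction N * (\<i> * ray_direction N) ^ k * ray_moment N k (of_real x) (of_real t)) / pi)"
    and "((deriv ^^ k) (\<lambda>y. ray_solution N y t) has_real_derivative
      Re (ray_direction N * (\<i> * ray_direction N) ^ Suc k *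
        ray_moment N (Suc k) (of_real x) (of_real t)) / pi) (at x)"
proof -
  let ?w = "ray_direction N"
  let ?h = "\<lambda>k x. Re (?w * (\<i> * ?w) ^ k * ray_moment N k (of_real x) (of_real t)) / pi"
  have deriv: "(?h k has_real_derivative ?h (Suc k) x) (at x)" for k x
  proof -
    have "((\<lambda>x. ray_moment N k (of_real x) (of_real t)) has_vector_derivative
        \<i> * ?w * ray_moment N (Suc k) (of_real x) (of_real t)) (at x)"
      using N t by (intro has_vector_derivative_real_field ray_moment_has_field_derivative_x) auto
    then have "((\<lambda>x. ?w * (\<i> * ?w) ^ k * ray_moment N k (of_real x) (of_real t)) has_vector_derivative
        ?w * (\<i> * ?w) ^ k * (\<i> * ?w * ray_moment N (Suc k) (of_real x) (of_real t))) (at x)"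
      by (rule has_vector_derivative_mult_right)
    then have "((\<lambda>x. Re (?w * (\<i> * ?w) ^ k * ray_moment N k (of_real x) (of_real t))) has_field_derivative
        Re (?w * (\<i> * ?w) ^ k * (\<i> * ?w * ray_moment N (Suc k) (of_real x) (of_real t)))) (at x)"
      by (rule has_field_derivative_Re)
    then show ?thesis
      by (auto dest!: DERIV_cdivide[where c = pi] simp: mult_ac)
  qed
  show *: "(deriv ^^ k) (\<lambda>y. ray_solution N y t) = ?h k" for k
  proof (induction k)
    case 0
    show ?case by (simp add: ray_solution_def)
  next
    case (Suc k)
    then show ?case using deriv[THEN DERIV_imp_deriv] by auto
  qed
  show "((deriv ^^ k) (\<lambda>y. ray_solution N y t) has_real_derivative ?h (Suc k) x) (at x)"
    unfolding * by (rule deriv)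
qed

lemma solves_pde_ray_solution:
  assumes "n \<ge> 1"
  shows "solves_pde n (ray_solution (2 * n + 1))"
  unfolding solves_pde_def
proof (intro allI impI conjI)
  fix t x :: real and k assume t: "t > 0"
  let ?N = "2 * n + 1"
  let ?w = "ray_direction ?N"
  have N: "?N \<ge> 2" using assms by simp
  show "(deriv ^^ k) (\<lambda>y. ray_solution ?N y t) differentiable (at x)"
    using deriv_power_ray_solution(2)[OF N t] by (auto simp: real_differentiable_def)
  have "((\<lambda>s. ray_moment ?N 0 (of_real x) (of_real s)) has_vector_derivative
      - ray_moment ?N (0 + ?N) (of_real x) (of_real t)) (at t)"
    using N t by (intro has_vector_derivative_real_field ray_moment_has_field_derivative_t) auto
  then have "((\<lambda>s. ?w * ray_moment ?N 0 (of_real x) (of_real s)) has_vector_derivative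
      ?w * - ray_moment ?N ?N (of_real x) (of_real t)) (at t)"
    using has_vector_derivative_mult_right by fastforce
  then have "((\<lambda>s. Re (?w * ray_moment ?N 0 (of_real x) (of_real s))) has_real_derivative
      Re (?w * - ray_moment ?N ?N (of_real x) (of_real t))) (at t)"
    by (rule has_field_derivative_Re)
  then have *: "(ray_solution ?N x has_real_derivative
      Re (?w * - ray_moment ?N ?N (of_real x) (of_real t)) / pi) (at t)"
    unfolding ray_solution_def by (rule DERIV_cdivide)
  \<comment> \<open>\<open>i^N w^N = i^(2n+1) i = (-1)^(n+1)\<close>, and the extra minus sign is
    the one in the factor \<open>- y^N\<close> produced by the time derivative.\<close>
  have "(\<i> * ?w) ^ ?N = - ((- 1) ^ n)"
    by (simp add: power_mult_distrib ray_direction_power power_mult del: power_Suc)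
       (simp add: power_mult, simp add: mult.commute)
  then have "(-1) ^ n * (deriv ^^ ?N) (\<lambda>y. ray_solution ?N y t) x =
      Re (?w * - ray_moment ?N ?N (of_real x) (of_real t)) / pi"
    unfolding deriv_power_ray_solution(1)[OF N t]
    by (cases "even n") (simp_all del: power_Suc)
  then show "(ray_solution ?N x has_real_derivative
      (-1) ^ n * (deriv ^^ ?N) (\<lambda>y. ray_solution ?N y t) x) (at t)"
    using * by simp
qed

section \<open>Rotation of the contour\<close>

text \<open>Jordan's inequality: sine is concave here, so its graph lies above the chord between the
  endpoints. It makes the exponent on the arc decay linearly in the angle.\<close>

lemma sin_ge_chord:
  fixes x :: real
  assumes "0 \<le> x" "x \<le> pi / 2"
  shows "2 / pi * x \<le> sin x"
proof -
  have "concave_on {0..pi / 2} sin"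
  proof (rule f''_le0_imp_concave)
    show "(sin has_real_derivative cos x) (at x)" for x :: real
      by (auto intro!: derivative_eq_intros)
    show "(cos has_real_derivative - sin x) (at x)" for x :: real
      by (auto intro!: derivative_eq_intros)
    show "- sin x \<le> 0" if "x \<in> {0..pi / 2}" for x :: real
      using that sin_ge_zero[of x] by auto
  qed simp
  then have "(1 - u) * sin 0 + u * sin (pi / 2) \<le> sin ((1 - u) *\<^sub>R 0 + u *\<^sub>R (pi / 2))"
    if "0 \<le> u" "u \<le> 1" for u
    using that by (intro concave_onD) auto
  from this[of "2 * x / pi"] show ?thesis
    using assms by (simp add: field_simps)
qed

text \<open>The sign is opposite to that in \<open>inverse_fourier_symbol\<close>; for odd
  \<open>N\<close> the substitution of - \<beta> for \<beta> converts one into the other. With this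
  sign and \<open>t > 0\<close> the contour turns into the upper half-plane.\<close>

definition oscillation :: "nat \<Rightarrow> real \<Rightarrow> real \<Rightarrow> real \<Rightarrow> complex" where
  "oscillation N x t \<beta> = exp (\<i> * of_real (\<beta> * x + t * \<beta> ^ N))"

definition half_oscillation_integral :: "nat \<Rightarrow> real \<Rightarrow> real \<Rightarrow> real \<Rightarrow> complex" where
  "half_oscillation_integral N x t R = (\<integral>\<beta>. indicator {0..R} \<beta> *\<^sub>R oscillation N x t \<beta> \<partial>lborel)"

lemma continuous_on_oscillation [continuous_intros]: "continuous_on A (oscillation N x t)"
  unfolding oscillation_def by (intro continuous_intros)

lemma continuous_on_ray_integrand [continuous_intros]: "continuous_on A (ray_integrand N k z t)"
  unfolding ray_integrand_def by (intro continuous_intros)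

text \<open>At \<open>z = R e^(is)\<close> the exponent has real part
  \<open>- x R sin s - t R^N sin (N s)\<close>. The angle runs only up to pi/(2N), so
  \<open>N s\<close> stays in [0, pi/2] and Jordan's inequality applies; with |sin s| \<le> s the
  real part is at most \<open>- K s\<close>. Integrating \<open>R exp (- K s)\<close> gives
  \<open>R / K\<close>.\<close>

lemma arc_bound:
  fixes x t R :: real
  assumes N: "N \<ge> 2" and t: "t > 0" and R: "R > 0"
    and K: "K = 2 * real N / pi * t * R ^ N - \<bar>x\<bar> * R" "K > 0"
    and F: "\<And>z. (F has_field_derivative exp (\<i> * of_real x * z + \<i> * of_real t * z ^ N)) (at z)"
  shows "norm (F (of_real R * ray_direction N) - F (of_real R)) \<le> R / K"
proof -
  define \<theta> where "\<theta> = pi / (2 * real N)"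
  have \<theta>: "\<theta> > 0" "real N * \<theta> = pi / 2" using N by (auto simp: \<theta>_def)
  let ?g = "\<lambda>s. F (of_real R * cis s)"
  let ?g' = "\<lambda>s. exp (\<i> * of_real x * (of_real R * cis s) + \<i> * of_real t * (of_real R * cis s) ^ N)
      * (of_real R * (\<i> * cis s))"
  \<comment> \<open>A primitive of the majorant \<open>R exp (- K s)\<close>; comparing increments
    of \<open>F\<close> with its increments takes the place of a contour integral.\<close>
  let ?\<phi> = "\<lambda>s. - (R / K) * exp (- K * s)"
  have g': "(?g has_vector_derivative ?g' s) (at s)" for s
  proof -
    have "((\<lambda>s. of_real R * cis s) has_vector_derivative (of_real R * (\<i> * cis s))) (at s)"
    proof (rule has_vector_derivative_mult_right)
      have "((\<lambda>z. exp (\<i> * z)) has_field_derivative \<i> * exp (\<i> * of_real s)) (at (of_real s))"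
        by (auto intro!: derivative_eq_intros)
      then show "(cis has_vector_derivative \<i> * cis s) (at s)"
        unfolding cis_conv_exp by (rule has_vector_derivative_real_field)
    qed
    from field_vector_diff_chain_at[OF this F] show ?thesis
      by (simp add: o_def mult.commute)
  qed
  have \<phi>': "(?\<phi> has_vector_derivative R * exp (- K * s)) (at s)" for s
    unfolding has_real_derivative_iff_has_vector_derivative[symmetric]
    using K(2) by (auto intro!: derivative_eq_intros)
  have "norm (?g \<theta> - ?g 0) \<le> ?\<phi> \<theta> - ?\<phi> 0"
  proof (rule differentiable_bound_general[OF \<theta>(1)])
    show "continuous_on {0..\<theta>} ?g"
      by (rule continuous_on_vector_derivative) (rule has_vector_derivative_at_within[OF g'])
    show "continuous_on {0..\<theta>} ?\<phi>" by (intro continuous_intros)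
    show "(?g has_vector_derivative ?g' s) (at s)" for s by (rule g')
    show "(?\<phi> has_vector_derivative R * exp (- K * s)) (at s)" for s by (rule \<phi>')
    fix s assume s: "0 < s" "s < \<theta>"
    have "\<bar>x * R * sin s\<bar> \<le> \<bar>x\<bar> * R * s"
      using R s abs_sin_x_le_abs_x[of s] by (simp add: abs_mult mult_left_mono)
    then have 1: "- (x * R * sin s) \<le> \<bar>x\<bar> * R * s" by linarith
    have "real N * s \<le> pi / 2"
      using s \<theta> N by (metis less_eq_real_def mult_left_mono of_nat_0_le_iff)
    then have "2 / pi * (N * s) \<le> sin (N * s)"
      using s by (intro sin_ge_chord) auto
    then have "t * R ^ N * (2 / pi * (N * s)) \<le> t * R ^ N * sin (N * s)"
      using t R by (intro mult_left_mono) auto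
    then have "- (x * R * sin s) - t * R ^ N * sin (N * s) \<le> - K * s"
      using 1 unfolding K(1) by (simp add: algebra_simps)
    moreover have "Re (\<i> * of_real x * (of_real R * cis s) + \<i> * of_real t * (of_real R * cis s) ^ N)
        = - (x * R * sin s) - t * R ^ N * sin (N * s)"
    proof -
      have "(of_real R * cis s) ^ N = of_real (R ^ N) * cis (real N * s)"
        by (simp add: power_mult_distrib Complex.DeMoivre)
      then show ?thesis by (simp only:) simp
    qed
    ultimately have "norm (exp (\<i> * of_real x * (of_real R * cis s)
        + \<i> * of_real t * (of_real R * cis s) ^ N)) \<le> exp (- K * s)"
      by (simp only: norm_exp_eq_Re exp_le_cancel_iff)
    from mult_left_mono[OF this, of R] show "norm (?g' s) \<le> R * exp (- K * s)"
      using R by (simp add: norm_mult mult.commute del: norm_exp_eq_Re)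
  qed
  also have "?\<phi> \<theta> - ?\<phi> 0 \<le> R / K"
    using R K(2) by simp
  finally show ?thesis by (simp add: ray_direction_def \<theta>_def norm_minus_commute)
qed

text \<open>The integrand is entire and so has a global primitive \<open>F\<close>. Both segments
  start at 0, hence their integrals differ by the increment of \<open>F\<close> along the arc
  between \<open>R\<close> and \<open>R w\<close>, and only the arc estimate remains.\<close>

lemma half_oscillation_integral_rotate:
  fixes x t R :: real
  assumes N: "N \<ge> 2" and t: "t > 0" and R: "R > 0"
    and K: "K = 2 * real N / pi * t * R ^ N - \<bar>x\<bar> * R" "K > 0"
  shows "norm (half_oscillation_integral N x t R - ray_direction N *
    (\<integral>y. indicator {0..R} y *\<^sub>R ray_integrand N 0 (of_real x) (of_real t) y \<partial>lborel)) \<le> R / K"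
proof -
  let ?w = "ray_direction N"
  let ?f = "\<lambda>z. exp (\<i> * of_real x * z + \<i> * of_real t * z ^ N)"
  have "?f holomorphic_on UNIV" by (intro holomorphic_intros)
  then obtain F where F: "\<And>z. (F has_field_derivative ?f z) (at z)"
    using holomorphic_convex_primitive'[of UNIV ?f] by auto
  have real: "half_oscillation_integral N x t R = F (of_real R) - F (of_real 0)"
    unfolding half_oscillation_integral_def
  proof (rule integral_FTC_Icc)
    show "((\<lambda>\<beta>. F (of_real \<beta>)) has_vector_derivative oscillation N x t \<beta>) (at \<beta> within {0..R})" for \<beta>
      using has_vector_derivative_real_field[OF F[of "of_real \<beta>"]]
      by (auto simp: oscillation_def algebra_simps intro: has_vector_derivative_at_within)
  qed (use R in \<open>auto intro: continuous_intros\<close>)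
  have ray: "(\<integral>y. indicator {0..R} y *\<^sub>R (?w * ray_integrand N 0 (of_real x) (of_real t) y) \<partial>lborel)
      = F (of_real R * ?w) - F (of_real 0 * ?w)"
  proof (rule integral_FTC_Icc)
    fix y :: real
    have "((\<lambda>y. of_real y * ?w) has_vector_derivative ?w) (at y)"
      by (auto intro!: derivative_eq_intros simp: has_vector_derivative_def scaleR_conv_of_real)
    from field_vector_diff_chain_at[OF this F]
    have "((\<lambda>y. F (of_real y * ?w)) has_vector_derivative ?w * ?f (of_real y * ?w)) (at y)"
      by (simp add: o_def)
    \<comment> \<open>\<open>(y w)^N = i y^N\<close> turns the oscillating term into
      \<open>i t (y w)^N = - t y^N\<close>.\<close>
    moreover have "?f (of_real y * ?w) = ray_integrand N 0 (of_real x) (of_real t) y"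
    proof -
      have "(of_real y * ?w) ^ N = of_real y ^ N * \<i>"
        using N by (simp add: power_mult_distrib ray_direction_power)
      then show ?thesis unfolding ray_integrand_def by (simp only:) (simp add: algebra_simps)
    qed
    ultimately show "((\<lambda>y. F (of_real y * ?w)) has_vector_derivative
        ?w * ray_integrand N 0 (of_real x) (of_real t) y) (at y within {0..R})"
      by (auto intro: has_vector_derivative_at_within)
  qed (use R in \<open>auto intro!: continuous_intros\<close>)
  have "half_oscillation_integral N x t R -
      ?w * (\<integral>y. indicator {0..R} y *\<^sub>R ray_integrand N 0 (of_real x) (of_real t) y \<partial>lborel)
      = F (of_real R) - F (of_real R * ?w)"
  proof -
    have "?w * (\<integral>y. indicator {0..R} y *\<^sub>R ray_integrand N 0 (of_real x) (of_real t) y \<partial>lborel) =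
        (\<integral>y. indicator {0..R} y *\<^sub>R (?w * ray_integrand N 0 (of_real x) (of_real t) y) \<partial>lborel)"
      by (subst integral_mult_right_zero[symmetric]) (simp add: mult_ac)
    then show ?thesis using real ray by simp
  qed
  then show ?thesis
    using arc_bound[OF N t R K F] by (simp add: norm_minus_commute)
qed

text \<open>For \<open>R\<close> \<ge> 1 one has R^N \<ge> R^2, so the constant \<open>K\<close> of
  the arc estimate is at least \<open>(c R - X) R\<close> with \<open>c = 2 N t / pi\<close>. The
  factor \<open>R\<close> cancels and leaves a bound that is the same for all |x| \<le>
  \<open>X\<close>.\<close>

lemma half_oscillation_integral_rotate_uniform:
  fixes x t R :: real
  assumes N: "N \<ge> 2" and t: "t > 0" and x: "\<bar>x\<bar> \<le> X"
    and R: "R \<ge> 1" "2 * real N / pi * t * R > X"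
  shows "norm (half_oscillation_integral N x t R - ray_direction N *
    (\<integral>y. indicator {0..R} y *\<^sub>R ray_integrand N 0 (of_real x) (of_real t) y \<partial>lborel))
    \<le> 1 / (2 * real N / pi * t * R - X)"
proof -
  define c where "c = 2 * real N / pi * t"
  have c: "c > 0" using N t by (simp add: c_def)
  have "R\<^sup>2 \<le> R ^ N" using N R by (intro power_increasing) auto
  then have "c * R\<^sup>2 \<le> c * R ^ N" using c by simp
  moreover have "\<bar>x\<bar> * R \<le> X * R" using x R by (intro mult_right_mono) auto
  ultimately have K: "(c * R - X) * R \<le> c * R ^ N - \<bar>x\<bar> * R"
    by (simp add: algebra_simps power2_eq_square)
  have "c * R > X" unfolding c_def by (rule R(2))
  then have pos: "0 < (c * R - X) * R" using R(1) by simp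
  have pos2: "0 < c * R ^ N - \<bar>x\<bar> * R" using order_less_le_trans[OF pos K] .
  have "R / (c * R ^ N - \<bar>x\<bar> * R) \<le> R / ((c * R - X) * R)"
    using R(1) by (intro divide_left_mono[OF K] mult_pos_pos[OF pos2 pos]) auto
  also have "\<dots> = 1 / (c * R - X)" using R by simp
  finally have "R / (c * R ^ N - \<bar>x\<bar> * R) \<le> 1 / (c * R - X)" .
  moreover have "norm (half_oscillation_integral N x t R - ray_direction N *
      (\<integral>y. indicator {0..R} y *\<^sub>R ray_integrand N 0 (of_real x) (of_real t) y \<partial>lborel))
      \<le> R / (c * R ^ N - \<bar>x\<bar> * R)"
    by (rule half_oscillation_integral_rotate[OF N t _ _ pos2]) (use R(1) in \<open>simp_all add: c_def\<close>)
  ultimately show ?thesis by (simp add: c_def)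
qed

lemma ray_moment_truncated_tendsto:
  assumes "N \<ge> 2" "Re t > 0"
  shows "((\<lambda>R. \<integral>y. indicator {0..R} y *\<^sub>R ray_integrand N k z t y \<partial>lborel) \<longlongrightarrow>
    ray_moment N k z t) at_top"
  unfolding ray_moment_def
proof (rule integral_dominated_convergence_at_top
    [where w = "\<lambda>y. norm (indicator {0..} y *\<^sub>R ray_integrand N k z t y)"])
  let ?f = "ray_integrand N k z t"
  show "integrable lborel (\<lambda>y. norm (indicator {0..} y *\<^sub>R ?f y))"
    using assms by (intro integrable_norm integrable_ray_integrand)
  show "AE y in lborel. ((\<lambda>R. indicator {0..R} y *\<^sub>R ?f y) \<longlongrightarrow> indicator {0..} y *\<^sub>R ?f y) at_top"
  proof (rule AE_I2)
    fix y :: real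
    have "eventually (\<lambda>R. indicator {0..R} y *\<^sub>R ?f y = indicator {0..} y *\<^sub>R ?f y) at_top"
      using eventually_ge_at_top[of y] by eventually_elim (auto split: split_indicator)
    then show "((\<lambda>R. indicator {0..R} y *\<^sub>R ?f y) \<longlongrightarrow> indicator {0..} y *\<^sub>R ?f y) at_top"
      by (rule tendsto_eventually)
  qed
qed (auto split: split_indicator)

lemma half_oscillation_integral_tendsto:
  assumes N: "N \<ge> 2" and t: "t > 0"
  shows "(half_oscillation_integral N x t \<longlongrightarrow>
      ray_direction N * ray_moment N 0 (of_real x) (of_real t)) at_top"
proof -
  let ?f = "ray_integrand N 0 (of_real x) (of_real t)"
  let ?J = "\<lambda>R. ray_direction N * (\<integral>y. indicator {0..R} y *\<^sub>R ?f y \<partial>lborel)"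
  have J: "(?J \<longlongrightarrow> ray_direction N * ray_moment N 0 (of_real x) (of_real t)) at_top"
    using N t by (intro tendsto_mult_left ray_moment_truncated_tendsto) auto
  define c where "c = 2 * real N / pi * t"
  have c: "c > 0" using N t by (simp add: c_def)
  have "((\<lambda>R. half_oscillation_integral N x t R - ?J R) \<longlongrightarrow> 0) at_top"
  proof (rule Lim_null_comparison)
    have "filterlim (\<lambda>R. c * R) at_top at_top"
      using c by (intro filterlim_tendsto_pos_mult_at_top[OF tendsto_const] filterlim_ident)
    then have "eventually (\<lambda>R. c * R > \<bar>x\<bar>) at_top"
      by (simp add: filterlim_at_top_dense)
    then show "eventually (\<lambda>R. norm (half_oscillation_integral N x t R - ?J R) \<le> 1 / (c * R - \<bar>x\<bar>)) at_top"
      using eventually_ge_at_top[of 1]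
      by eventually_elim
         (use half_oscillation_integral_rotate_uniform[OF N t order_refl] in \<open>simp add: c_def\<close>)
    show "((\<lambda>R. 1 / (c * R - \<bar>x\<bar>)) \<longlongrightarrow> 0) at_top"
      using c by real_asymp
  qed
  from tendsto_add[OF this J] show ?thesis by simp
qed

text \<open>Supplies the dominating constant when the oscillatory integral is tested against a
  compactly supported function: the ray part is bounded by the integral of its majorant, the arc
  part by 1.\<close>

lemma half_oscillation_integral_bounded:
  assumes N: "N \<ge> 2" and t: "t > 0"
  shows "\<exists>C R0. \<forall>x R. \<bar>x\<bar> \<le> X \<longrightarrow> R \<ge> R0 \<longrightarrow> norm (half_oscillation_integral N x t R) \<le> C"
proof -
  define c where "c = 2 * real N / pi * t"
  have c: "c > 0" using N t by (simp add: c_def)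
  let ?h = "\<lambda>y. exp ((X + 1)\<^sup>2 / (4 * t) + t) * (indicator {0..} y * (y ^ 0 * exp (- y)))"
  have h: "integrable lborel ?h"
    by (intro integrable_mult_right integrable_power_times_exp_Ici)
  \<comment> \<open>From \<open>(X + 1) / c\<close> on, \<open>c R - X\<close> is at least 1, which
    bounds the arc part by 1; the 1 in the maximum is the condition \<open>R\<close> \<ge> 1 of the
    uniform estimate.\<close>
  have "norm (half_oscillation_integral N x t R) \<le> 1 + integral\<^sup>L lborel ?h"
    if x: "\<bar>x\<bar> \<le> X" and R: "R \<ge> max 1 ((X + 1) / c)" for x R
  proof -
    let ?f = "ray_integrand N 0 (of_real x) (of_real t)"
    let ?J = "ray_direction N * (\<integral>y. indicator {0..R} y *\<^sub>R ?f y \<partial>lborel)"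
    have "c * R \<ge> X + 1" using R c by (simp add: field_simps)
    then have cR: "1 / (c * R - X) \<le> 1" "c * R > X" by simp_all
    have "norm (half_oscillation_integral N x t R - ?J) \<le> 1 / (c * R - X)"
      unfolding c_def
      by (rule half_oscillation_integral_rotate_uniform[OF N t x])
         (use R cR(2) in \<open>simp_all only: c_def max.bounded_iff\<close>)
    then have "norm (half_oscillation_integral N x t R - ?J) \<le> 1"
      using cR(1) by linarith
    moreover have "norm ?J \<le> integral\<^sup>L lborel ?h"
    proof -
      have "norm (\<integral>y. indicator {0..R} y *\<^sub>R ?f y \<partial>lborel) \<le> integral\<^sup>L lborel ?h"
      proof (rule Bochner_Integration.integral_norm_bound_integral[OF _ h])
        show "integrable lborel (\<lambda>y. indicator {0..R} y *\<^sub>R ?f y)"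
          by (rule borel_integrable_compact) (auto intro: continuous_intros)
        show "norm (indicator {0..R} y *\<^sub>R ?f y) \<le> ?h y" for y
        proof -
          have "norm (indicator {0..R} y *\<^sub>R ?f y) \<le> norm (indicator {0..} y *\<^sub>R ?f y)"
            by (simp split: split_indicator)
          also have "\<dots> \<le> ?h y"
            using N t x by (intro norm_indicator_ray_integrand_le) auto
          finally show ?thesis .
        qed
      qed
      then show ?thesis by (simp add: norm_mult)
    qed
    ultimately show ?thesis
      using norm_triangle_sub[of "half_oscillation_integral N x t R" ?J] by linarith
  qed
  then show ?thesis by blast
qed

section \<open>From the half line to the whole line\<close>

lemma cnj_oscillation: "odd N \<Longrightarrow> cnj (oscillation N x t \<beta>) = oscillation N x t (- \<beta>)"
  by (simp add: oscillation_def exp_cnj algebra_simps)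

lemma has_integral_oscillation:
  assumes "R \<ge> 0"
  shows "(oscillation N x t has_integral half_oscillation_integral N x t R) {0..R}"
proof -
  have "integrable lborel (\<lambda>\<beta>. indicator {0..R} \<beta> *\<^sub>R oscillation N x t \<beta>)"
    by (rule borel_integrable_compact) (auto intro: continuous_intros)
  from has_integral_integral_lborel[OF this]
  have "((\<lambda>\<beta>. if \<beta> \<in> {0..R} then oscillation N x t \<beta> else 0) has_integral
      half_oscillation_integral N x t R) UNIV"
    unfolding half_oscillation_integral_def
    by (simp add: indicator_scaleR_eq_if)
  then show ?thesis by (simp only: has_integral_restrict_UNIV)
qed

text \<open>The endpoints are independent because the gauge integral over the line is tested on
  arbitrary large intervals. After splitting at 0, reflection carries the left piece to
  \<open>[0, -A]\<close>; on the right piece the sign change is conjugation, as \<open>N\<close> is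
  odd.\<close>

lemma has_integral_oscillation_reflected:
  assumes N: "odd N" and AB: "A \<le> 0" "0 \<le> B"
  shows "((\<lambda>\<beta>. oscillation N x t (- \<beta>)) has_integral
    half_oscillation_integral N x t (- A) + cnj (half_oscillation_integral N x t B)) {A..B}"
proof (rule has_integral_combine[OF AB])
  show "((\<lambda>\<beta>. oscillation N x t (- \<beta>)) has_integral half_oscillation_integral N x t (- A)) {A..0}"
    using has_integral_oscillation[of "- A"] AB
    by (subst has_integral_reflect_real[symmetric]) simp
  show "((\<lambda>\<beta>. oscillation N x t (- \<beta>)) has_integral cnj (half_oscillation_integral N x t B)) {0..B}"
    using has_integral_oscillation[OF AB(2), of N x t]
    by (subst cnj_oscillation[OF N, symmetric]) (simp add: has_integral_cnj[unfolded o_def])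
qed

lemma inverse_fourier_symbol_ray_solution:
  assumes "n \<ge> 1"
  shows "inverse_fourier_symbol n (ray_solution (2 * n + 1))"
  unfolding inverse_fourier_symbol_def
proof (intro allI impI)
  fix t x :: real assume t: "t > 0"
  let ?N = "2 * n + 1"
  let ?L = "ray_direction ?N * ray_moment ?N 0 (of_real x) (of_real t)"
  let ?H = "half_oscillation_integral ?N x t"
  let ?g = "\<lambda>\<beta>. oscillation ?N x t (- \<beta>)"
  have N: "?N \<ge> 2" "odd ?N" using assms by auto
  have sum: "?L + cnj ?L = of_real (2 * pi * ray_solution ?N x t)"
    unfolding complex_add_cnj ray_solution_def by (intro arg_cong[where f = of_real]) simp
  have "(?g has_integral ?L + cnj ?L) UNIV"
    unfolding has_integral_alt'
  proof (intro conjI allI impI)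
    show "(\<lambda>\<beta>. if \<beta> \<in> UNIV then ?g \<beta> else 0) integrable_on cbox A B" for A B
      unfolding oscillation_def
      by (simp only: cbox_interval UNIV_I if_True)
         (intro integrable_continuous_interval continuous_intros)
    fix e :: real assume "e > 0"
    then have "eventually (\<lambda>R. dist (?H R) ?L < e / 2) at_top"
      by (intro tendstoD[OF half_oscillation_integral_tendsto[OF N(1) t, of x]]) simp
    then obtain R0 where R0: "\<And>R. R \<ge> R0 \<Longrightarrow> norm (?H R - ?L) < e / 2"
      by (auto simp: eventually_at_top_linorder dist_norm)
    show "\<exists>B>0. \<forall>a b. ball 0 B \<subseteq> cbox a b \<longrightarrow>
        norm (integral (cbox a b) (\<lambda>\<beta>. if \<beta> \<in> UNIV then ?g \<beta> else 0) - (?L + cnj ?L)) < e"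
    proof (intro exI conjI allI impI)
      \<comment> \<open>The maximum with 1 makes the radius positive and forces \<open>a\<close>
        \<le> 0 \<le> \<open>b\<close>, so that the integral may be split at 0; each half then
        contributes an error below \<open>e / 2\<close>.\<close>
      show "max 1 R0 > 0" by simp
      fix a b :: real assume "ball 0 (max 1 R0) \<subseteq> cbox a b"
      then have "- max 1 R0 \<ge> a" "max 1 R0 \<le> b"
        by (auto simp: ball_eq_greaterThanLessThan greaterThanLessThan_subseteq_atLeastAtMost_iff)
      then have ab: "a \<le> 0" "0 \<le> b" "- a \<ge> R0" "b \<ge> R0" by auto
      have "integral (cbox a b) ?g = ?H (- a) + cnj (?H b)"
        using has_integral_oscillation_reflected[OF N(2) ab(1,2), of x t]
        by (simp add: integral_unique)
      then have eq: "integral (cbox a b) ?g - (?L + cnj ?L) = (?H (- a) - ?L) + cnj (?H b - ?L)"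
        by simp
      have "norm (cnj (?H b - ?L)) < e / 2"
        using R0[OF ab(4)] by (simp only: complex_mod_cnj)
      then have "norm ((?H (- a) - ?L) + cnj (?H b - ?L)) < e"
        using R0[OF ab(3)] norm_triangle_ineq[of "?H (- a) - ?L" "cnj (?H b - ?L)"] by linarith
      then have "norm (integral (cbox a b) ?g - (?L + cnj ?L)) < e"
        unfolding eq .
      then show "norm (integral (cbox a b) (\<lambda>\<beta>. if \<beta> \<in> UNIV then ?g \<beta> else 0) - (?L + cnj ?L)) < e"
        by (simp only: UNIV_I if_True)
    qed
  qed
  from has_integral_divide[OF this, of "2 * of_real pi"]
  have "((\<lambda>\<beta>. ?g \<beta> / (2 * of_real pi)) has_integral of_real (ray_solution ?N x t)) UNIV"
    unfolding sum by simp
  then show "((\<lambda>\<beta>. exp (- \<i> * of_real (\<beta> * x) - \<i> * of_real (t * \<beta> ^ ?N)) / (2 * of_real pi))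
      has_integral of_real (ray_solution ?N x t)) UNIV"
    by (simp add: oscillation_def algebra_simps)
qed

section \<open>The initial datum\<close>

lemma has_vector_derivative_zero_outside:
  fixes f :: "real \<Rightarrow> 'a::real_normed_vector"
  assumes "(f has_vector_derivative f') (at x)" "\<forall>y. X < \<bar>y\<bar> \<longrightarrow> f y = 0" "X < \<bar>x\<bar>"
  shows "f' = 0"
proof -
  have "open {y::real. X < \<bar>y\<bar>}" by (intro open_Collect_less continuous_intros)
  then have "((\<lambda>y. 0) has_vector_derivative f') (at x)"
    by (rule has_vector_derivative_transform_within_open[OF assms(1)]) (use assms(2,3) in auto)
  then show ?thesis using vector_derivative_unique_at has_vector_derivative_const by blast
qed

lemma integrable_compact_support:
  fixes f :: "real \<Rightarrow> 'a::{banach, second_countable_topology}"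
  assumes "continuous_on UNIV f" "\<forall>x. X < \<bar>x\<bar> \<longrightarrow> f x = 0"
  shows "integrable lborel f"
proof -
  have "integrable lborel (\<lambda>x. indicator {- X..X} x *\<^sub>R f x)"
    by (rule borel_integrable_compact) (use assms(1) in \<open>auto intro: continuous_on_subset\<close>)
  moreover have "indicator {- X..X} x *\<^sub>R f x = f x" for x
    using assms(2) by (auto split: split_indicator simp: abs_le_iff not_le)
  ultimately show ?thesis by simp
qed

text \<open>Serves as integration by parts without boundary terms when \<open>f\<close> is a
  product: the boundary values are taken outside the support.\<close>

lemma integral_derivative_compact_support:
  fixes f :: "real \<Rightarrow> 'a::euclidean_space"
  assumes f': "\<And>x. (f has_vector_derivative f' x) (at x)"
    and cont: "continuous_on UNIV f'" and supp: "\<forall>x. X < \<bar>x\<bar> \<longrightarrow> f x = 0"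
  shows "(\<integral>x. f' x \<partial>lborel) = 0"
proof -
  \<comment> \<open>\<open>X\<close> may be negative; this choice is positive and lies strictly
    beyond the support bound.\<close>
  define Y where "Y = \<bar>X\<bar> + 1"
  have "(\<integral>x. indicator {- Y..Y} x *\<^sub>R f' x \<partial>lborel) = f Y - f (- Y)"
    by (rule integral_FTC_Icc)
       (use f' cont in \<open>auto simp: Y_def intro: has_vector_derivative_at_within continuous_on_subset\<close>)
  moreover have "f' x = 0" if "X < \<bar>x\<bar>" for x
    using f' supp that by (rule has_vector_derivative_zero_outside)
  then have "indicator {- Y..Y} x *\<^sub>R f' x = f' x" for x
    by (auto split: split_indicator simp: Y_def)
  ultimately show ?thesis
    using supp by (simp add: Y_def)
qed

section \<open>Decay of Fourier transforms\<close>

text \<open>Sign and normalisation follow \<open>oscillation\<close>, so that an exchange of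
  integrals produces this transform directly; the factor 2 pi appears in the inversion
  formula.\<close>

definition fourier_transform :: "(real \<Rightarrow> real) \<Rightarrow> real \<Rightarrow> complex" where
  "fourier_transform \<phi> \<beta> = (\<integral>x. \<phi> x *\<^sub>R exp (\<i> * of_real (\<beta> * x)) \<partial>lborel)"

lemma fourier_transform_measurable [measurable]:
  assumes [measurable]: "\<phi> \<in> borel_measurable borel"
  shows "fourier_transform \<phi> \<in> borel_measurable borel"
  unfolding fourier_transform_def by measurable

lemma norm_fourier_transform_le:
  "norm (fourier_transform \<phi> \<beta>) \<le> (\<integral>x. \<bar>\<phi> x\<bar> \<partial>lborel)"
  unfolding fourier_transform_def
  by (rule order_trans[OF integral_norm_bound]) (simp add: norm_exp_i_times)

text \<open>Integrating the derivative of \<phi>(x) e^(i \<beta> x) shows that the transform of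
  \<phi>' is - i \<beta> times that of \<phi>. Only moduli are recorded, since decay is the
  purpose.\<close>

lemma norm_fourier_transform_derivative:
  assumes \<phi>': "\<And>x. (\<phi> has_real_derivative \<phi>' x) (at x)" and cont: "continuous_on UNIV \<phi>'"
    and supp: "\<forall>x. X < \<bar>x\<bar> \<longrightarrow> \<phi> x = 0"
  shows "norm (fourier_transform \<phi>' \<beta>) = \<bar>\<beta>\<bar> * norm (fourier_transform \<phi> \<beta>)"
proof -
  let ?e = "\<lambda>x. exp (\<i> * of_real (\<beta> * x))"
  have cont0: "continuous_on UNIV \<phi>"
    using \<phi>' by (auto intro!: continuous_at_imp_continuous_on DERIV_isCont)
  have supp': "\<forall>x. X < \<bar>x\<bar> \<longrightarrow> \<phi>' x = 0"
    using has_vector_derivative_zero_outside[OF \<phi>'[unfolded has_real_derivative_iff_has_vector_derivative] supp]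
    by blast
  have "(\<integral>x. \<phi> x *\<^sub>R (\<i> * of_real \<beta> * ?e x) + \<phi>' x *\<^sub>R ?e x \<partial>lborel) = 0"
  proof (rule integral_derivative_compact_support)
    fix x
    have "((\<lambda>x. exp (\<i> * (of_real \<beta> * x))) has_field_derivative \<i> * of_real \<beta> * ?e x) (at (of_real x))"
      by (auto intro!: derivative_eq_intros)
    then have "(?e has_vector_derivative \<i> * of_real \<beta> * ?e x) (at x)"
      by (drule_tac has_vector_derivative_real_field) simp
    then show "((\<lambda>x. \<phi> x *\<^sub>R ?e x) has_vector_derivative \<phi> x *\<^sub>R (\<i> * of_real \<beta> * ?e x) + \<phi>' x *\<^sub>R ?e x) (at x)"
      by (rule has_vector_derivative_scaleR[OF \<phi>'])
    show "\<forall>x. X < \<bar>x\<bar> \<longrightarrow> \<phi> x *\<^sub>R ?e x = 0"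
      using supp by simp
  qed (intro continuous_intros cont cont0)
  moreover have "integrable lborel (\<lambda>x. \<phi> x *\<^sub>R (\<i> * of_real \<beta> * ?e x))" "integrable lborel (\<lambda>x. \<phi>' x *\<^sub>R ?e x)"
    using supp supp' by (auto intro!: integrable_compact_support[of _ X] continuous_intros cont cont0)
  ultimately have "(\<integral>x. \<phi> x *\<^sub>R (\<i> * of_real \<beta> * ?e x) \<partial>lborel) + fourier_transform \<phi>' \<beta> = 0"
    by (simp add: fourier_transform_def)
  moreover have "(\<integral>x. \<phi> x *\<^sub>R (\<i> * of_real \<beta> * ?e x) \<partial>lborel) = \<i> * of_real \<beta> * fourier_transform \<phi> \<beta>"
    unfolding fourier_transform_def by (subst integral_mult_right_zero[symmetric]) simp
  ultimately have "fourier_transform \<phi>' \<beta> = - (\<i> * of_real \<beta> * fourier_transform \<phi> \<beta>)"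
    by (simp add: eq_neg_iff_add_eq_0 add.commute)
  then show ?thesis by (simp add: norm_mult)
qed

text \<open>Two integrations by parts bound \<beta>^2 times the transform by the L1 norm of
  \<phi>''. Adding the trivial bound by the L1 norm of \<phi> gives decay like 1/(1 +
  \<beta>^2).\<close>

lemma integrable_fourier_transform:
  assumes \<phi>': "\<And>x. (\<phi> has_real_derivative \<phi>' x) (at x)"
    and \<phi>'': "\<And>x. (\<phi>' has_real_derivative \<phi>'' x) (at x)" and cont: "continuous_on UNIV \<phi>''"
    and supp: "\<forall>x. X < \<bar>x\<bar> \<longrightarrow> \<phi> x = 0"
  shows "integrable lborel (fourier_transform \<phi>)"
proof -
  let ?F = "fourier_transform"
  have cont0: "continuous_on UNIV \<phi>" and cont1: "continuous_on UNIV \<phi>'"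
    using \<phi>' \<phi>'' by (auto intro!: continuous_at_imp_continuous_on DERIV_isCont)
  have supp': "\<forall>x. X < \<bar>x\<bar> \<longrightarrow> \<phi>' x = 0"
    using has_vector_derivative_zero_outside[OF \<phi>'[unfolded has_real_derivative_iff_has_vector_derivative] supp]
    by blast
  define B where "B = (\<integral>x. \<bar>\<phi> x\<bar> \<partial>lborel) + (\<integral>x. \<bar>\<phi>'' x\<bar> \<partial>lborel)"
  have bound: "norm (?F \<phi> \<beta>) \<le> B * inverse (1 + \<beta>\<^sup>2)" for \<beta>
  proof -
    have "norm (?F \<phi>'' \<beta>) = \<beta>\<^sup>2 * norm (?F \<phi> \<beta>)"
      using norm_fourier_transform_derivative[OF \<phi>'' cont supp']
        norm_fourier_transform_derivative[OF \<phi>' cont1 supp]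
      by (simp add: power2_eq_square)
    then have "(1 + \<beta>\<^sup>2) * norm (?F \<phi> \<beta>) \<le> B"
      using norm_fourier_transform_le[of \<phi> \<beta>] norm_fourier_transform_le[of \<phi>'' \<beta>]
      by (simp add: B_def algebra_simps)
    moreover have "1 + \<beta>\<^sup>2 > 0" by (simp add: add_pos_nonneg)
    ultimately show ?thesis by (simp add: field_simps)
  qed
  have "integrable lborel (\<lambda>\<beta>::real. inverse (1 + \<beta>\<^sup>2))"
    using integrable_inverse_1_plus_square by (simp add: set_integrable_def)
  then have "integrable lborel (\<lambda>\<beta>. B * inverse (1 + \<beta>\<^sup>2))" by simp
  then show ?thesis
  proof (rule Bochner_Integration.integrable_bound)
    have [measurable]: "\<phi> \<in> borel_measurable borel"
      using cont0 by (rule borel_measurable_continuous_onI)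
    show "?F \<phi> \<in> borel_measurable lborel" by simp
    show "AE \<beta> in lborel. norm (?F \<phi> \<beta>) \<le> norm (B * inverse (1 + \<beta>\<^sup>2))"
      using bound by (intro AE_I2) (smt (verit) real_norm_def)
  qed
qed

section \<open>Testing truncated oscillatory integrals\<close>

definition truncated_oscillation_integral :: "nat \<Rightarrow> real \<Rightarrow> real \<Rightarrow> real \<Rightarrow> complex" where
  "truncated_oscillation_integral N x t R = (\<integral>\<beta>. indicator {- R..R} \<beta> *\<^sub>R oscillation N x t \<beta> \<partial>lborel)"

lemma truncated_oscillation_integral_measurable [measurable]:
  "(\<lambda>x. truncated_oscillation_integral N x t R) \<in> borel_measurable borel"
  unfolding truncated_oscillation_integral_def oscillation_def by measurable

text \<open>The double integrand has modulus |\<phi>(x)| times the indicator of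
  \<open>[-R,R]\<close>, so Fubini applies; the time factor does not involve \<open>x\<close> and
  leaves the Fourier transform as inner integral.\<close>

lemma integral_truncated_oscillation_integral:
  assumes \<phi>: "integrable lborel \<phi>" and R: "R \<ge> 0"
  shows "(\<integral>x. \<phi> x *\<^sub>R truncated_oscillation_integral N x t R \<partial>lborel) =
    (\<integral>\<beta>. indicator {- R..R} \<beta> *\<^sub>R (exp (\<i> * of_real (t * \<beta> ^ N)) * fourier_transform \<phi> \<beta>) \<partial>lborel)"
proof -
  have [measurable]: "\<phi> \<in> borel_measurable borel" using \<phi> by auto
  let ?f = "\<lambda>x \<beta>. \<phi> x *\<^sub>R indicator {- R..R} \<beta> *\<^sub>R oscillation N x t \<beta>"
  have "integrable (lborel \<Otimes>\<^sub>M lborel) (\<lambda>(x, \<beta>). ?f x \<beta>)"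
  proof (rule lborel_pair.Fubini_integrable)
    show "(\<lambda>(x, \<beta>). ?f x \<beta>) \<in> borel_measurable (lborel \<Otimes>\<^sub>M lborel)"
      unfolding oscillation_def by measurable
    have "norm (?f x \<beta>) = \<bar>\<phi> x\<bar> * indicator {- R..R} \<beta>" for x \<beta>
      by (simp add: oscillation_def norm_exp_i_times split: split_indicator)
    then have "(\<integral>\<beta>. norm (?f x \<beta>) \<partial>lborel) = \<bar>\<phi> x\<bar> * (2 * R)" for x
      using R by simp
    then show "integrable lborel (\<lambda>x. \<integral>\<beta>. norm (case (x, \<beta>) of (x, \<beta>) \<Rightarrow> ?f x \<beta>) \<partial>lborel)"
      using \<phi> by simp
    show "AE x in lborel. integrable lborel (\<lambda>\<beta>. case (x, \<beta>) of (x, \<beta>) \<Rightarrow> ?f x \<beta>)"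
      by (simp only: prod.case)
         (intro AE_I2 integrable_scaleR_right borel_integrable_compact continuous_intros compact_Icc)
  qed
  then have "(\<integral>\<beta>. (\<integral>x. ?f x \<beta> \<partial>lborel) \<partial>lborel) = (\<integral>x. (\<integral>\<beta>. ?f x \<beta> \<partial>lborel) \<partial>lborel)"
    by (rule lborel_pair.Fubini_integral)
  moreover have "(\<integral>\<beta>. ?f x \<beta> \<partial>lborel) = \<phi> x *\<^sub>R truncated_oscillation_integral N x t R" for x
    unfolding truncated_oscillation_integral_def by (rule integral_scaleR_right)
  moreover have "(\<integral>x. ?f x \<beta> \<partial>lborel) =
      indicator {- R..R} \<beta> *\<^sub>R (exp (\<i> * of_real (t * \<beta> ^ N)) * fourier_transform \<phi> \<beta>)" for \<beta>
  proof -
    have "?f x \<beta> = indicator {- R..R} \<beta> *\<^sub>R (exp (\<i> * of_real (t * \<beta> ^ N)) *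
        (\<phi> x *\<^sub>R exp (\<i> * of_real (\<beta> * x))))" for x
      by (simp add: oscillation_def distrib_left exp_add mult_ac)
    then show ?thesis
      by (simp only: integral_scaleR_right integral_mult_right_zero fourier_transform_def)
  qed
  ultimately show ?thesis by simp
qed

text \<open>On the frequency side the truncation is removed by dominated convergence, the transform
  itself being the majorant. The case \<open>t > 0\<close> evaluates the solution tested against
  \<phi>; the case \<open>t = 0\<close> gives Fourier inversion.\<close>

lemma integral_truncated_oscillation_integral_tendsto:
  assumes \<phi>: "integrable lborel \<phi>" and F: "integrable lborel (fourier_transform \<phi>)"
  shows "((\<lambda>R. \<integral>x. \<phi> x *\<^sub>R truncated_oscillation_integral N x t R \<partial>lborel) \<longlongrightarrow>
    (\<integral>\<beta>. exp (\<i> * of_real (t * \<beta> ^ N)) * fourier_transform \<phi> \<beta> \<partial>lborel)) at_top"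
proof -
  let ?g = "\<lambda>\<beta>. exp (\<i> * of_real (t * \<beta> ^ N)) * fourier_transform \<phi> \<beta>"
  have [measurable]: "\<phi> \<in> borel_measurable borel" using \<phi> by auto
  have "((\<lambda>R. \<integral>\<beta>. indicator {- R..R} \<beta> *\<^sub>R ?g \<beta> \<partial>lborel) \<longlongrightarrow> (\<integral>\<beta>. ?g \<beta> \<partial>lborel)) at_top"
  proof (rule integral_dominated_convergence_at_top[where w = "\<lambda>\<beta>. norm (fourier_transform \<phi> \<beta>)"])
    show "AE \<beta> in lborel. ((\<lambda>R. indicator {- R..R} \<beta> *\<^sub>R ?g \<beta>) \<longlongrightarrow> ?g \<beta>) at_top"
    proof (rule AE_I2)
      fix \<beta> :: real
      have "eventually (\<lambda>R. indicator {- R..R} \<beta> *\<^sub>R ?g \<beta> = ?g \<beta>) at_top"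
        using eventually_ge_at_top[of "\<bar>\<beta>\<bar>"]
        by eventually_elim (auto split: split_indicator)
      then show "((\<lambda>R. indicator {- R..R} \<beta> *\<^sub>R ?g \<beta>) \<longlongrightarrow> ?g \<beta>) at_top"
        by (rule tendsto_eventually)
    qed
    show "\<forall>\<^sub>F R in at_top. AE \<beta> in lborel. norm (indicator {- R..R} \<beta> *\<^sub>R ?g \<beta>) \<le> norm (fourier_transform \<phi> \<beta>)"
      by (auto simp: norm_mult norm_exp_i_times split: split_indicator)
  qed (use F in auto)
  then show ?thesis
  proof (rule Lim_transform_eventually)
    show "\<forall>\<^sub>F R in at_top. (\<integral>\<beta>. indicator {- R..R} \<beta> *\<^sub>R ?g \<beta> \<partial>lborel) =
        (\<integral>x. \<phi> x *\<^sub>R truncated_oscillation_integral N x t R \<partial>lborel)"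
      using eventually_ge_at_top[of 0]
      by eventually_elim (simp only: integral_truncated_oscillation_integral[OF \<phi>])
  qed
qed

lemma truncated_oscillation_integral_eq:
  assumes N: "odd N" and R: "R \<ge> 0"
  shows "truncated_oscillation_integral N x t R = of_real (2 * Re (half_oscillation_integral N x t R))"
proof -
  have "integrable lborel (\<lambda>\<beta>. indicator {- R..R} \<beta> *\<^sub>R oscillation N x t \<beta>)"
    by (rule borel_integrable_compact) (auto intro: continuous_intros)
  from has_integral_integral_lborel[OF this]
  have "((\<lambda>\<beta>. if \<beta> \<in> {- R..R} then oscillation N x t \<beta> else 0) has_integral
      truncated_oscillation_integral N x t R) UNIV"
    unfolding truncated_oscillation_integral_def by (simp add: indicator_scaleR_eq_if)
  then have "(oscillation N x t has_integral truncated_oscillation_integral N x t R) {- R..R}"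
    by (simp only: has_integral_restrict_UNIV)
  moreover have "(oscillation N x t has_integral
      half_oscillation_integral N x t R + cnj (half_oscillation_integral N x t R)) {- R..R}"
    using has_integral_oscillation_reflected[OF N, of "- R" R x t] R
    by (subst has_integral_reflect_real[symmetric]) simp
  ultimately show ?thesis
    by (metis complex_add_cnj has_integral_unique)
qed

section \<open>Fourier inversion at the origin\<close>

text \<open>This is the Dirichlet kernel 2 sin (R x) / x, written with \<open>sinc\<close> because
  that is the derivative of the sine integral. The primitive divides by \<open>i x\<close>, hence
  the exclusion of 0, a null set.\<close>

lemma truncated_oscillation_integral_0:
  assumes x: "x \<noteq> 0" and R: "R \<ge> 0"
  shows "truncated_oscillation_integral N x 0 R = of_real (2 * R * sinc (R * x))"
proof -
  let ?E = "\<lambda>\<beta>. exp (\<i> * of_real (\<beta> * x)) / (\<i> * of_real x)"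
  have "truncated_oscillation_integral N x 0 R = ?E R - ?E (- R)"
    unfolding truncated_oscillation_integral_def
  proof (rule integral_FTC_Icc)
    fix \<beta>
    have "\<i> * of_real x \<noteq> 0" using x by simp
    then have "((\<lambda>z. exp (z * (\<i> * of_real x)) / (\<i> * of_real x)) has_field_derivative
        exp (of_real \<beta> * (\<i> * of_real x))) (at (of_real \<beta>))"
      by (auto intro!: derivative_eq_intros simp del: mult_eq_0_iff)
    from has_vector_derivative_real_field[OF this]
    show "(?E has_vector_derivative oscillation N x 0 \<beta>) (at \<beta> within {- R..R})"
      by (auto simp: oscillation_def mult_ac intro: has_vector_derivative_at_within)
  qed (use R in \<open>auto intro: continuous_intros\<close>)
  also have "\<dots> = of_real (2 * sin (R * x) / x)"
  proof -
    have "?E R - ?E (- R) = (cis (R * x) - cis (- (R * x))) / (\<i> * of_real x)"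
      by (simp add: cis_conv_exp diff_divide_distrib)
    also have "cis (R * x) - cis (- (R * x)) = \<i> * of_real (2 * sin (R * x))"
      by (simp add: complex_eq_iff)
    finally show ?thesis by simp
  qed
  also have "2 * sin (R * x) / x = 2 * R * sinc (R * x)"
    using x by auto
  finally show ?thesis .
qed

lemma Si_0: "Si 0 = 0"
  using Si_neg[of 0] by simp

lemma Si_scaled_tendsto: "((\<lambda>R. Si (R * x)) \<longlongrightarrow> pi / 2 * sgn x) at_top"
proof (cases x "0 :: real" rule: linorder_cases)
  case equal
  then show ?thesis by (simp add: Si_0)
next
  case greater
  then have "filterlim (\<lambda>R. R * x) at_top at_top" by real_asymp
  then show ?thesis using filterlim_compose[OF Si_at_top] greater by simp
next
  case less
  then have "filterlim (\<lambda>R. R * (- x)) at_top at_top" by real_asymp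
  then have "((\<lambda>R. - Si (R * (- x))) \<longlongrightarrow> - (pi / 2)) at_top"
    by (intro tendsto_minus filterlim_compose[OF Si_at_top])
  then have "((\<lambda>R. Si (R * x)) \<longlongrightarrow> - (pi / 2)) at_top"
  proof (rule Lim_transform_eventually)
    show "\<forall>\<^sub>F R in at_top. - Si (R * (- x)) = Si (R * x)"
      using eventually_ge_at_top[of 0]
      by eventually_elim (use less Si_neg[of "_ * - x"] in \<open>simp add: mult_nonneg_nonpos\<close>)
  qed
  then show ?thesis using less by simp
qed

text \<open>The Dirichlet kernel has no integrable majorant uniform in \<open>R\<close>, but its
  primitive \<open>2 Si (R x)\<close> is bounded. Moving the derivative onto \<phi> therefore
  permits dominated convergence; \<open>Si (R x)\<close> tends to (pi/2) sgn x, and the integral of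
  \<phi>' sgn is - 2 \<phi>(0).\<close>

lemma integral_fourier_transform:
  assumes \<phi>': "\<And>x. (\<phi> has_real_derivative \<phi>' x) (at x)"
    and \<phi>'': "\<And>x. (\<phi>' has_real_derivative \<phi>'' x) (at x)" and cont: "continuous_on UNIV \<phi>''"
    and supp: "\<forall>x. X < \<bar>x\<bar> \<longrightarrow> \<phi> x = 0"
  shows "(\<integral>\<beta>. fourier_transform \<phi> \<beta> \<partial>lborel) = of_real (2 * pi * \<phi> 0)"
proof -
  have cont0: "continuous_on UNIV \<phi>" and cont1: "continuous_on UNIV \<phi>'"
    using \<phi>' \<phi>'' by (auto intro!: continuous_at_imp_continuous_on DERIV_isCont)
  have [measurable]: "\<phi> \<in> borel_measurable borel" "\<phi>' \<in> borel_measurable borel"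
    using cont0 cont1 by (auto intro: borel_measurable_continuous_onI)
  have supp': "\<forall>x. X < \<bar>x\<bar> \<longrightarrow> \<phi>' x = 0"
    using has_vector_derivative_zero_outside[OF \<phi>'[unfolded has_real_derivative_iff_has_vector_derivative] supp]
    by blast
  have int: "integrable lborel \<phi>" "integrable lborel \<phi>'"
    using supp supp' by (auto intro!: integrable_compact_support[of _ X] cont0 cont1)
  \<comment> \<open>At time 0 the oscillation is exp (i \<beta> x) for every exponent; 0 is taken as
    the default exponent.\<close>
  have parts: "(\<integral>x. \<phi> x *\<^sub>R truncated_oscillation_integral 0 x 0 R \<partial>lborel) =
      of_real (- 2 * (\<integral>x. \<phi>' x * Si (R * x) \<partial>lborel))" if R: "R \<ge> 0" for R
  proof -
    have S: "((\<lambda>x. Si (R * x)) has_real_derivative R * sinc (R * x)) (at x)" for x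
    proof -
      have "((\<lambda>x. R * x) has_real_derivative R) (at x)"
        by (auto intro!: derivative_eq_intros)
      from DERIV_chain2[OF DERIV_Si this] show ?thesis by (simp add: mult.commute)
    qed
    have contS: "continuous_on UNIV (\<lambda>x. Si (R * x))"
      using S by (auto intro!: continuous_at_imp_continuous_on DERIV_isCont)
    have "(\<integral>x. \<phi> x * (R * sinc (R * x)) + \<phi>' x * Si (R * x) \<partial>lborel) = 0"
    proof (rule integral_derivative_compact_support)
      show "((\<lambda>x. \<phi> x * Si (R * x)) has_vector_derivative
          \<phi> x * (R * sinc (R * x)) + \<phi>' x * Si (R * x)) (at x)" for x
        unfolding has_real_derivative_iff_has_vector_derivative[symmetric]
        using DERIV_mult[OF \<phi>' S, of x] by (simp add: algebra_simps)
      show "\<forall>x. X < \<bar>x\<bar> \<longrightarrow> \<phi> x * Si (R * x) = 0"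
        using supp by simp
    qed (intro continuous_intros cont0 cont1 contS)
    moreover have "integrable lborel (\<lambda>x. \<phi> x * (R * sinc (R * x)))"
      by (rule integrable_compact_support[of _ X], intro continuous_intros cont0) (use supp in simp)
    moreover have "integrable lborel (\<lambda>x. \<phi>' x * Si (R * x))"
      by (rule integrable_compact_support[of _ X], intro continuous_intros cont1 contS) (use supp' in simp)
    ultimately have *: "(\<integral>x. \<phi> x * (R * sinc (R * x)) \<partial>lborel) = - (\<integral>x. \<phi>' x * Si (R * x) \<partial>lborel)"
      by simp
    have "(\<integral>x. \<phi> x *\<^sub>R truncated_oscillation_integral 0 x 0 R \<partial>lborel) =
        (\<integral>x. of_real (2 * (\<phi> x * (R * sinc (R * x)))) \<partial>lborel)"
    proof (rule integral_cong_AE)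
      show "AE x in lborel. \<phi> x *\<^sub>R truncated_oscillation_integral 0 x 0 R =
          of_real (2 * (\<phi> x * (R * sinc (R * x))))"
        using AE_lborel_singleton[of "0::real"]
        by eventually_elim (simp add: truncated_oscillation_integral_0 R scaleR_conv_of_real)
    qed measurable
    also have "\<dots> = of_real (2 * (\<integral>x. \<phi> x * (R * sinc (R * x)) \<partial>lborel))"
      by (simp only: integral_complex_of_real integral_mult_right_zero)
    finally show ?thesis unfolding * by simp
  qed
  obtain B where B: "\<And>y. \<bar>Si y\<bar> \<le> B" using bounded_Si by blast
  have "((\<lambda>R. \<integral>x. \<phi>' x * Si (R * x) \<partial>lborel) \<longlongrightarrow> (\<integral>x. \<phi>' x * (pi / 2 * sgn x) \<partial>lborel)) at_top"
  proof (rule integral_dominated_convergence_at_top[where w = "\<lambda>x. \<bar>\<phi>' x\<bar> * B"])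
    show "AE x in lborel. ((\<lambda>R. \<phi>' x * Si (R * x)) \<longlongrightarrow> \<phi>' x * (pi / 2 * sgn x)) at_top"
      by (intro AE_I2 tendsto_mult_left Si_scaled_tendsto)
    show "\<forall>\<^sub>F R in at_top. AE x in lborel. norm (\<phi>' x * Si (R * x)) \<le> \<bar>\<phi>' x\<bar> * B"
      using B by (intro always_eventually allI AE_I2) (simp add: abs_mult mult_left_mono)
  qed (use int in auto)
  moreover have "(\<integral>x. \<phi>' x * (pi / 2 * sgn x) \<partial>lborel) = - pi * \<phi> 0"
  proof -
    define Y where "Y = \<bar>X\<bar> + 1"
    have half: "(\<integral>x. indicator {A..B} x *\<^sub>R \<phi>' x \<partial>lborel) = \<phi> B - \<phi> A"
      "integrable lborel (\<lambda>x. indicator {A..B} x *\<^sub>R \<phi>' x)" if "A \<le> B" for A B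
    proof -
      show "(\<integral>x. indicator {A..B} x *\<^sub>R \<phi>' x \<partial>lborel) = \<phi> B - \<phi> A"
        by (rule integral_FTC_Icc[OF that])
           (use \<phi>' cont1 in \<open>auto simp: has_real_derivative_iff_has_vector_derivative
             intro: has_vector_derivative_at_within continuous_on_subset\<close>)
      show "integrable lborel (\<lambda>x. indicator {A..B} x *\<^sub>R \<phi>' x)"
        by (rule borel_integrable_compact) (use cont1 in \<open>auto intro: continuous_on_subset\<close>)
    qed
    have Y: "\<phi> Y = 0" "\<phi> (- Y) = 0" "Y > 0" using supp by (auto simp: Y_def)
    \<comment> \<open>At \<open>x = 0\<close> both closed indicators are 1 and cancel, in accordance
      with \<open>sgn 0 = 0\<close>; beyond \<open>Y\<close> the derivative vanishes.\<close>
    have sgn: "\<phi>' x * (pi / 2 * sgn x) =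
        pi / 2 * (indicator {0..Y} x *\<^sub>R \<phi>' x - indicator {- Y..0} x *\<^sub>R \<phi>' x)" for x
      using supp' by (cases x "0 :: real" rule: linorder_cases)
        (auto simp: Y_def sgn_if split: split_indicator)
    have "(\<integral>x. \<phi>' x * (pi / 2 * sgn x) \<partial>lborel) =
        pi / 2 * ((\<phi> Y - \<phi> 0) - (\<phi> 0 - \<phi> (- Y)))"
      unfolding sgn integral_mult_right_zero
      using half[of 0 Y] half[of "- Y" 0] Y(3)
      by (subst Bochner_Integration.integral_diff) (simp_all del: real_scaleR_def)
    then show ?thesis using Y by (simp add: field_simps)
  qed
  ultimately have "((\<lambda>R. complex_of_real (- 2 * (\<integral>x. \<phi>' x * Si (R * x) \<partial>lborel))) \<longlongrightarrow>
      of_real (- 2 * (- pi * \<phi> 0))) at_top"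
    by (intro tendsto_of_real tendsto_mult_left) simp
  then have "((\<lambda>R. \<integral>x. \<phi> x *\<^sub>R truncated_oscillation_integral 0 x 0 R \<partial>lborel) \<longlongrightarrow>
      of_real (- 2 * (- pi * \<phi> 0))) at_top"
    by (rule Lim_transform_eventually)
       (use eventually_ge_at_top[of 0] in \<open>eventually_elim, simp only: parts\<close>)
  moreover have "((\<lambda>R. \<integral>x. \<phi> x *\<^sub>R truncated_oscillation_integral 0 x 0 R \<partial>lborel) \<longlongrightarrow>
      (\<integral>\<beta>. exp (\<i> * of_real (0 * \<beta> ^ 0)) * fourier_transform \<phi> \<beta> \<partial>lborel)) at_top"
    by (rule integral_truncated_oscillation_integral_tendsto[OF int(1)
          integrable_fourier_transform[OF \<phi>' \<phi>'' cont supp]])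
  ultimately have "(\<integral>\<beta>. exp (\<i> * of_real (0 * \<beta> ^ 0)) * fourier_transform \<phi> \<beta> \<partial>lborel) =
      of_real (- 2 * (- pi * \<phi> 0))"
    by (rule tendsto_unique[OF trivial_limit_at_top_linorder, rotated])
  then show ?thesis by simp
qed

text \<open>The truncated kernel integrated against \<phi> has two limits as \<open>R\<close> grows,
  which must agree. In \<open>x\<close> the pointwise limit is 2 pi times the solution, with
  majorant 2 C |\<phi>| where \<open>C\<close> is uniform on the support; in frequency the limit is
  the right-hand side.\<close>

lemma integral_ray_solution:
  assumes N: "odd N" "N \<ge> 2" and t: "t > 0"
    and \<phi>: "continuous_on UNIV \<phi>" and supp: "\<forall>x. X < \<bar>x\<bar> \<longrightarrow> \<phi> x = 0"
    and F: "integrable lborel (fourier_transform \<phi>)"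
  shows "of_real (2 * pi * (\<integral>x. ray_solution N x t * \<phi> x \<partial>lborel)) =
    (\<integral>\<beta>. exp (\<i> * of_real (t * \<beta> ^ N)) * fourier_transform \<phi> \<beta> \<partial>lborel)"
proof -
  have [measurable]: "\<phi> \<in> borel_measurable borel"
    using \<phi> by (rule borel_measurable_continuous_onI)
  have int: "integrable lborel \<phi>"
    using supp by (intro integrable_compact_support[of _ X] \<phi>)
  have contU: "continuous_on UNIV (\<lambda>x. ray_solution N x t)"
    using deriv_power_ray_solution(2)[OF N(2) t, of 0]
    by (auto intro!: continuous_at_imp_continuous_on DERIV_isCont)
  then have [measurable]: "(\<lambda>x. ray_solution N x t) \<in> borel_measurable borel"
    by (rule borel_measurable_continuous_onI)
  let ?T = "\<lambda>x. truncated_oscillation_integral N x t"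
  obtain C R0 where C: "\<forall>x R. \<bar>x\<bar> \<le> X \<longrightarrow> R \<ge> R0 \<longrightarrow> norm (half_oscillation_integral N x t R) \<le> C"
    using half_oscillation_integral_bounded[OF N(2) t] by blast
  have "((\<lambda>R. \<integral>x. \<phi> x *\<^sub>R ?T x R \<partial>lborel) \<longlongrightarrow>
      (\<integral>x. \<phi> x *\<^sub>R of_real (2 * (pi * ray_solution N x t)) \<partial>lborel)) at_top"
  proof (rule integral_dominated_convergence_at_top[where w = "\<lambda>x. \<bar>\<phi> x\<bar> * (2 * C)"])
    show "AE x in lborel. ((\<lambda>R. \<phi> x *\<^sub>R ?T x R) \<longlongrightarrow> \<phi> x *\<^sub>R of_real (2 * (pi * ray_solution N x t))) at_top"
    proof (intro AE_I2 tendsto_scaleR tendsto_const)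
      fix x
      have "((\<lambda>R. complex_of_real (2 * Re (half_oscillation_integral N x t R))) \<longlongrightarrow>
          of_real (2 * Re (ray_direction N * ray_moment N 0 (of_real x) (of_real t)))) at_top"
        by (intro tendsto_of_real tendsto_mult_left tendsto_Re half_oscillation_integral_tendsto N t)
      then have "((\<lambda>R. complex_of_real (2 * Re (half_oscillation_integral N x t R))) \<longlongrightarrow>
          of_real (2 * (pi * ray_solution N x t))) at_top"
        by (simp only: ray_solution_def) simp
      then show "(?T x \<longlongrightarrow> of_real (2 * (pi * ray_solution N x t))) at_top"
        by (rule Lim_transform_eventually)
           (use eventually_ge_at_top[of 0] in
             \<open>eventually_elim, simp only: truncated_oscillation_integral_eq[OF N(1)]\<close>)
    qed
    show "\<forall>\<^sub>F R in at_top. AE x in lborel. norm (\<phi> x *\<^sub>R ?T x R) \<le> \<bar>\<phi> x\<bar> * (2 * C)"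
      using eventually_ge_at_top[of "max 0 R0"]
    proof eventually_elim
      case (elim R)
      have "norm (\<phi> x *\<^sub>R ?T x R) \<le> \<bar>\<phi> x\<bar> * (2 * C)" for x
      proof (cases "X < \<bar>x\<bar>")
        case False
        then have "\<bar>Re (half_oscillation_integral N x t R)\<bar> \<le> C"
          using C[rule_format, of x R] abs_Re_le_cmod[of "half_oscillation_integral N x t R"] elim by auto
        moreover have "norm (?T x R) = 2 * \<bar>Re (half_oscillation_integral N x t R)\<bar>"
          using elim by (simp add: truncated_oscillation_integral_eq[OF N(1)] norm_mult)
        ultimately show ?thesis by (simp add: mult_left_mono)
      qed (simp add: supp)
      then show ?case by simp
    qed
  qed (use int in auto)
  moreover have "(\<integral>x. \<phi> x *\<^sub>R of_real (2 * (pi * ray_solution N x t)) \<partial>lborel) =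
      complex_of_real (2 * pi * (\<integral>x. ray_solution N x t * \<phi> x \<partial>lborel))"
  proof -
    have "\<phi> x *\<^sub>R of_real (2 * (pi * ray_solution N x t)) =
        complex_of_real (2 * pi * (ray_solution N x t * \<phi> x))" for x
      by (simp add: scaleR_conv_of_real mult_ac)
    then show ?thesis
      by (simp only: integral_complex_of_real integral_mult_right_zero)
  qed
  ultimately have "((\<lambda>R. \<integral>x. \<phi> x *\<^sub>R ?T x R \<partial>lborel) \<longlongrightarrow>
      complex_of_real (2 * pi * (\<integral>x. ray_solution N x t * \<phi> x \<partial>lborel))) at_top"
    by (simp only:)
  then show ?thesis
    by (rule tendsto_unique[OF trivial_limit_at_top_linorder])
       (rule integral_truncated_oscillation_integral_tendsto[OF int F])
qed

lemma integral_oscillation_tendsto: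
  assumes F: "integrable lborel F"
  shows "((\<lambda>t. \<integral>\<beta>. exp (\<i> * of_real (t * \<beta> ^ N)) * F \<beta> \<partial>lborel) \<longlongrightarrow> (\<integral>\<beta>. F \<beta> \<partial>lborel)) (at_right 0)"
  unfolding tendsto_at_iff_sequentially comp_def
proof (intro allI impI)
  fix T :: "nat \<Rightarrow> real" assume T: "T \<longlonglongrightarrow> 0"
  show "(\<lambda>i. \<integral>\<beta>. exp (\<i> * of_real (T i * \<beta> ^ N)) * F \<beta> \<partial>lborel) \<longlonglongrightarrow> (\<integral>\<beta>. F \<beta> \<partial>lborel)"
  proof (rule integral_dominated_convergence[where w = "\<lambda>\<beta>. norm (F \<beta>)"])
    show "AE \<beta> in lborel. (\<lambda>i. exp (\<i> * of_real (T i * \<beta> ^ N)) * F \<beta>) \<longlonglongrightarrow> F \<beta>"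
    proof (rule AE_I2)
      fix \<beta>
      have "(\<lambda>i. exp (\<i> * of_real (T i * \<beta> ^ N)) * F \<beta>) \<longlonglongrightarrow> exp (\<i> * of_real (0 * \<beta> ^ N)) * F \<beta>"
        by (intro tendsto_intros T)
      then show "(\<lambda>i. exp (\<i> * of_real (T i * \<beta> ^ N)) * F \<beta>) \<longlonglongrightarrow> F \<beta>" by simp
    qed
  qed (use F in \<open>auto simp: norm_mult norm_exp_i_times\<close>)
qed

lemma initial_delta_ray_solution:
  assumes "n \<ge> 1"
  shows "initial_delta (ray_solution (2 * n + 1))"
  unfolding initial_delta_def
proof (intro allI impI)
  fix \<phi> assume test: "test_function \<phi>"
  let ?N = "2 * n + 1"
  have N: "odd ?N" "?N \<ge> 2" using assms by auto
  have deriv: "((deriv ^^ k) \<phi> has_real_derivative (deriv ^^ Suc k) \<phi> x) (at x)" for k x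
    using test by (simp add: test_function_def DERIV_deriv_iff_real_differentiable)
  have cont: "continuous_on UNIV ((deriv ^^ k) \<phi>)" for k
    using deriv by (auto intro!: continuous_at_imp_continuous_on DERIV_isCont)
  obtain X where X: "\<forall>x\<in>{x. \<phi> x \<noteq> 0}. norm x \<le> X"
    using test by (auto simp: test_function_def bounded_iff)
  have supp: "\<forall>x. X < \<bar>x\<bar> \<longrightarrow> \<phi> x = 0"
    using X by force
  \<comment> \<open>Specialises the derivative facts to \<phi>, \<phi>' and \<phi>'', in the form of
    the first three hypotheses of the Fourier lemmas.\<close>
  note D = deriv[of 0, simplified] deriv[of 1, simplified] cont[of 2, simplified numeral_2_eq_2, simplified]
  have F: "integrable lborel (fourier_transform \<phi>)"
    by (rule integrable_fourier_transform[OF D supp])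
  have "((\<lambda>t. Re (\<integral>\<beta>. exp (\<i> * of_real (t * \<beta> ^ ?N)) * fourier_transform \<phi> \<beta> \<partial>lborel) / (2 * pi)) \<longlongrightarrow>
      Re (\<integral>\<beta>. fourier_transform \<phi> \<beta> \<partial>lborel) / (2 * pi)) (at_right 0)"
    by (intro tendsto_intros integral_oscillation_tendsto F) simp
  then have "((\<lambda>t. Re (\<integral>\<beta>. exp (\<i> * of_real (t * \<beta> ^ ?N)) * fourier_transform \<phi> \<beta> \<partial>lborel) / (2 * pi)) \<longlongrightarrow>
      \<phi> 0) (at_right 0)"
    by (simp add: integral_fourier_transform[OF D supp])
  then show "((\<lambda>t. \<integral>x. ray_solution ?N x t * \<phi> x \<partial>lborel) \<longlongrightarrow> \<phi> 0) (at_right 0)"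
  proof (rule Lim_transform_eventually)
    show "\<forall>\<^sub>F t in at_right 0. Re (\<integral>\<beta>. exp (\<i> * of_real (t * \<beta> ^ ?N)) * fourier_transform \<phi> \<beta> \<partial>lborel) / (2 * pi) =
        (\<integral>x. ray_solution ?N x t * \<phi> x \<partial>lborel)"
      using eventually_at_right_less[of 0]
    proof eventually_elim
      case (elim t)
      have "continuous_on UNIV \<phi>" using cont[of 0] by simp
      from integral_ray_solution[OF N elim this supp F]
      have "Re (\<integral>\<beta>. exp (\<i> * of_real (t * \<beta> ^ ?N)) * fourier_transform \<phi> \<beta> \<partial>lborel) =
          2 * pi * (\<integral>x. ray_solution ?N x t * \<phi> x \<partial>lborel)"
        by (metis Re_complex_of_real)
      then show ?case by (simp only:) simp
    qed
  qed
qed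

section \<open>The generalized gamma expectation\<close>

text \<open>The derivative of \<open>exp (c y - t y^N)\<close> along the ray is \<open>c\<close>
  times the integrand of order 0 minus \<open>N t\<close> times that of order \<open>N - 1\<close>.
  The boundary value at infinity is 0, and the one at the origin is the summand 1.\<close>

lemma ray_moment_by_parts:
  assumes N: "N \<ge> 2" and t: "Re t > 0"
  shows "of_nat N * t * ray_moment N (N - 1) z t = 1 + \<i> * z * ray_direction N * ray_moment N 0 z t"
proof -
  let ?c = "\<i> * z * ray_direction N"
  let ?f = "\<lambda>k. ray_integrand N k z t"
  let ?J = "\<lambda>k R. \<integral>y. indicator {0..R} y *\<^sub>R ?f k y \<partial>lborel"
  have parts: "?c * ?J 0 R - of_nat N * t * ?J (N - 1) R = ?f 0 R - 1" if R: "R \<ge> 0" for R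
  proof -
    have "(\<integral>y. indicator {0..R} y *\<^sub>R (?c * ?f 0 y - of_nat N * t * ?f (N - 1) y) \<partial>lborel) = ?f 0 R - ?f 0 0"
    proof (rule integral_FTC_Icc[OF R])
      fix y :: real
      have "((\<lambda>v. exp (?c * v - t * v ^ N)) has_field_derivative
          ?c * ?f 0 y - of_nat N * t * ?f (N - 1) y) (at (of_real y))"
        unfolding ray_integrand_def
        by (auto intro!: derivative_eq_intros simp: algebra_simps)
      from has_vector_derivative_real_field[OF this]
      show "(?f 0 has_vector_derivative ?c * ?f 0 y - of_nat N * t * ?f (N - 1) y) (at y within {0..R})"
        unfolding ray_integrand_def by (auto intro: has_vector_derivative_at_within)
    qed (intro continuous_intros)
    note ftc = this
    have int: "integrable lborel (\<lambda>y. indicator {0..R} y *\<^sub>R ?f k y)" for k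
      by (rule borel_integrable_compact) (auto intro: continuous_intros)
    have "(\<integral>y. indicator {0..R} y *\<^sub>R (?c * ?f 0 y - of_nat N * t * ?f (N - 1) y) \<partial>lborel) =
        (\<integral>y. ?c * (indicator {0..R} y *\<^sub>R ?f 0 y) - of_nat N * t * (indicator {0..R} y *\<^sub>R ?f (N - 1) y) \<partial>lborel)"
      by (intro Bochner_Integration.integral_cong refl) (simp split: split_indicator)
    also have "\<dots> = ?c * ?J 0 R - of_nat N * t * ?J (N - 1) R"
      by (subst Bochner_Integration.integral_diff)
         (intro integrable_mult_right int, intro integrable_mult_right int, simp only: integral_mult_right_zero)
    finally show ?thesis using ftc N by (simp add: ray_integrand_def power_0_left)
  qed
  have "(?f 0 \<longlongrightarrow> 0) at_top"
  proof (rule Lim_null_comparison)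
    let ?C = "exp ((norm z + 1)\<^sup>2 / (4 * Re t) + Re t)"
    show "eventually (\<lambda>R. norm (?f 0 R) \<le> ?C * exp (- R)) at_top"
      using eventually_ge_at_top[of 0]
      by eventually_elim (use norm_ray_integrand_le[OF N _ t order_refl order_refl, where k = 0] in simp)
    have "((\<lambda>R. ?C * exp (- R)) \<longlongrightarrow> ?C * 0) at_top"
      by (intro tendsto_mult_left) real_asymp
    then show "((\<lambda>R. ?C * exp (- R)) \<longlongrightarrow> 0) at_top" by simp
  qed
  then have "((\<lambda>R. ?f 0 R - 1) \<longlongrightarrow> 0 - 1) at_top"
    by (intro tendsto_intros)
  moreover have "((\<lambda>R. ?c * ?J 0 R - of_nat N * t * ?J (N - 1) R) \<longlongrightarrow>
      ?c * ray_moment N 0 z t - of_nat N * t * ray_moment N (N - 1) z t) at_top"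
    by (intro tendsto_diff tendsto_mult_left ray_moment_truncated_tendsto N t)
  then have "((\<lambda>R. ?f 0 R - 1) \<longlongrightarrow>
      ?c * ray_moment N 0 z t - of_nat N * t * ray_moment N (N - 1) z t) at_top"
    by (rule Lim_transform_eventually)
       (use eventually_ge_at_top[of 0] in \<open>eventually_elim, simp only: parts\<close>)
  ultimately have "0 - 1 = ?c * ray_moment N 0 z t - of_nat N * t * ray_moment N (N - 1) z t"
    by (rule tendsto_unique[OF trivial_limit_at_top_linorder])
  then show ?thesis by (simp add: algebra_simps)
qed

lemma gen_gamma_density_nonneg: "\<gamma> > 0 \<Longrightarrow> t > 0 \<Longrightarrow> 0 \<le> gen_gamma_density \<gamma> t x"
  by (simp add: gen_gamma_density_def)

text \<open>With parameter \<open>1/t\<close> the density is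
  \<open>N t y^(N-1) exp (- t y^N)\<close>, the real part of the ray integrand; the damped sine is
  the imaginary part of exp (i x w y).\<close>

lemma gen_gamma_density_times_ray:
  assumes N: "N \<ge> 2" and t: "t > 0"
  shows "gen_gamma_density (real N) (1 / t) y *
      (exp (- Im (ray_direction N) * x * y) * sin (Re (ray_direction N) * x * y)) =
    real N * t * Im (indicator {0..} y *\<^sub>R ray_integrand N (N - 1) (of_real x) (of_real t) y)"
proof (cases "y > 0")
  case True
  have "y powr (real N - 1) = y ^ (N - 1)"
    using True N by (subst powr_realpow[symmetric]) (auto simp: of_nat_diff)
  moreover have "y powr real N = y ^ N"
    using True by (rule powr_realpow)
  moreover have "exp (\<i> * of_real x * ray_direction N * of_real y - of_real t * of_real y ^ N) =
      of_real (exp (- (t * y ^ N))) * exp (\<i> * of_real x * ray_direction N * of_real y)"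
    by (simp add: exp_diff exp_minus field_simps flip: exp_of_real)
  moreover have "Im (exp (\<i> * of_real x * ray_direction N * of_real y)) =
      exp (- Im (ray_direction N) * x * y) * sin (Re (ray_direction N) * x * y)"
    by (simp add: Im_exp mult_ac)
  ultimately show ?thesis
    using True by (simp add: gen_gamma_density_def ray_integrand_def mult_ac flip: of_real_power)
next
  \<comment> \<open>At \<open>y = 0\<close> the indicator is 1 although the density is 0; both sides
    agree because \<open>N\<close> \<ge> 2 makes \<open>y^(N-1)\<close> vanish there.\<close>
  case False
  then show ?thesis
    using N by (cases "y = 0") (auto simp: gen_gamma_density_def ray_integrand_def)
qed

lemma gen_gamma_expectation:
  assumes N: "N \<ge> 2" and t: "t > 0"
    and X: "distributed M lborel X (\<lambda>y. ennreal (gen_gamma_density (real N) (1 / t) y))"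
  defines "g \<equiv> \<lambda>x y. exp (- Im (ray_direction N) * x * y) * sin (Re (ray_direction N) * x * y)"
  shows "integrable M (\<lambda>\<omega>. g x (X \<omega>))"
    and "(\<integral>\<omega>. g x (X \<omega>) \<partial>M) = pi * x * ray_solution N x t"
proof -
  let ?d = "gen_gamma_density (real N) (1 / t)"
  let ?h = "\<lambda>y. indicator {0..} y *\<^sub>R ray_integrand N (N - 1) (of_real x) (of_real t) y"
  have d: "0 \<le> ?d y" for y using N t by (intro gen_gamma_density_nonneg) auto
  have g: "g x \<in> borel_measurable lborel" unfolding g_def by measurable
  have h: "integrable lborel ?h" using N t by (intro integrable_ray_integrand) auto
  have eq: "?d y * g x y = real N * t * Im (?h y)" for y
    unfolding g_def by (rule gen_gamma_density_times_ray[OF N t])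
  have "integrable lborel (\<lambda>y. ?d y * g x y)"
    unfolding eq using h by (intro integrable_mult_right integrable_Im)
  then show "integrable M (\<lambda>\<omega>. g x (X \<omega>))"
    using distributed_integrable[OF X g d] by simp
  have "(\<integral>\<omega>. g x (X \<omega>) \<partial>M) = (\<integral>y. ?d y * g x y \<partial>lborel)"
    using distributed_integral[OF X g d] by simp
  also have "\<dots> = real N * t * Im (ray_moment N (N - 1) (of_real x) (of_real t))"
    unfolding eq ray_moment_def by (simp only: integral_mult_right_zero integral_Im[OF h])
  also have "\<dots> = Im (of_nat N * of_real t * ray_moment N (N - 1) (of_real x) (of_real t))"
    by (simp add: mult.assoc)
  \<comment> \<open>The summand 1 from the integration by parts is real and drops out; Im (i x z) =
    x Re z accounts for the factor \<open>x\<close>.\<close>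
  also have "\<dots> = x * Re (ray_direction N * ray_moment N 0 (of_real x) (of_real t))"
    using N t by (subst ray_moment_by_parts) (simp_all add: algebra_simps)
  finally show "(\<integral>\<omega>. g x (X \<omega>) \<partial>M) = pi * x * ray_solution N x t"
    by (simp add: ray_solution_def)
qed

section \<open>Characterisation of the fundamental solution\<close>

text \<open>Uniqueness is that of the gauge integral in the Fourier condition. Conversely, all three
  conditions see only positive times, so they pass between functions agreeing there: the time
  derivative through the open set \<open>{0<..}\<close>, the initial datum through the filter
  \<open>at_right 0\<close>.\<close>

lemma fundamental_solution_iff:
  assumes n: "n \<ge> 1"
  shows "fundamental_solution n u \<longleftrightarrow> (\<forall>t>0. \<forall>x. u x t = ray_solution (2 * n + 1) x t)"
proof (intro iffI allI impI)
  fix t x :: real assume u: "fundamental_solution n u" and t: "t > 0"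
  have "complex_of_real (u x t) = of_real (ray_solution (2 * n + 1) x t)"
    using u inverse_fourier_symbol_ray_solution[OF n] t
    unfolding fundamental_solution_def inverse_fourier_symbol_def by (meson has_integral_unique)
  then show "u x t = ray_solution (2 * n + 1) x t" by simp
next
  let ?U = "ray_solution (2 * n + 1)"
  assume u: "\<forall>t>0. \<forall>x. u x t = ?U x t"
  then have slice: "(\<lambda>y. u y t) = (\<lambda>y. ?U y t)" if "t > 0" for t
    using that by auto
  have "solves_pde n u"
    unfolding solves_pde_def
  proof (intro allI impI conjI)
    fix t x :: real assume t: "t > 0"
    show "(deriv ^^ k) (\<lambda>y. u y t) differentiable (at x)" if "k < 2 * n + 1" for k
      unfolding slice[OF t] using solves_pde_ray_solution[OF n] t that
      by (auto simp: solves_pde_def)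
    have "(?U x has_real_derivative (-1) ^ n * (deriv ^^ (2 * n + 1)) (\<lambda>y. u y t) x) (at t)"
      unfolding slice[OF t] using solves_pde_ray_solution[OF n] t
      by (simp only: solves_pde_def)
    then show "(u x has_real_derivative (-1) ^ n * (deriv ^^ (2 * n + 1)) (\<lambda>y. u y t) x) (at t)"
      by (rule has_field_derivative_transform_within_open[where S = "{0<..}"]) (use t u in auto)
  qed
  moreover have "initial_delta u"
    unfolding initial_delta_def
  proof (intro allI impI)
    fix \<phi> assume "test_function \<phi>"
    then have "((\<lambda>t. \<integral>x. ?U x t * \<phi> x \<partial>lborel) \<longlongrightarrow> \<phi> 0) (at_right 0)"
      using initial_delta_ray_solution[OF n] by (simp add: initial_delta_def)
    then show "((\<lambda>t. \<integral>x. u x t * \<phi> x \<partial>lborel) \<longlongrightarrow> \<phi> 0) (at_right 0)"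
      by (rule Lim_transform_eventually)
         (use eventually_at_right_less[of 0] in \<open>eventually_elim, simp add: u\<close>)
  qed
  moreover have "inverse_fourier_symbol n u"
    using inverse_fourier_symbol_ray_solution[OF n] u by (simp add: inverse_fourier_symbol_def)
  ultimately show "fundamental_solution n u" by (simp add: fundamental_solution_def)
qed

text \<open>Integrability is a separate claim because the integral of a non-integrable function is 0
  by convention, so an equation alone would not assert that the expectation exists. Division by 0
  also gives 0, hence the formula is claimed for \<open>x\<close> \<noteq> 0 and the origin enters
  through a limit. The equivalence expresses both that the formula gives a fundamental solution and
  that no other exists for \<open>t > 0\<close>.\<close>

theorem theorem2p1:
  fixes n :: nat and a b :: real
    and M :: "'a measure" and G :: "real \<Rightarrow> 'a \<Rightarrow> real"
    and u :: "real \<Rightarrow> real \<Rightarrow> real"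
  assumes n: "n \<ge> 1"
    and a: "a = cos (pi / (2 * (2 * real n + 1)))"
    and b: "b = sin (pi / (2 * (2 * real n + 1)))"
    and M: "prob_space M"
    and G: "\<And>s. s > 0 \<Longrightarrow>
      distributed M lborel (G s) (\<lambda>x. ennreal (gen_gamma_density (2 * real n + 1) s x))"
  shows "(\<forall>t>0. \<forall>x. integrable M (\<lambda>\<omega>. exp (- b * x * G (1/t) \<omega>) * sin (a * x * G (1/t) \<omega>))) \<and>
    (fundamental_solution n u \<longleftrightarrow>
      (\<forall>t>0.
        (\<forall>x. x \<noteq> 0 \<longrightarrow> u x t =
          1 / (pi * x) * (\<integral>\<omega>. exp (- b * x * G (1/t) \<omega>) * sin (a * x * G (1/t) \<omega>) \<partial>M)) \<and>
        ((\<lambda>x. 1 / (pi * x) * (\<integral>\<omega>. exp (- b * x * G (1/t) \<omega>) * sin (a * x * G (1/t) \<omega>) \<partial>M))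
          \<longlongrightarrow> u 0 t) (at 0)))"
proof -
  let ?N = "2 * n + 1"
  let ?U = "ray_solution ?N"
  let ?g = "\<lambda>t x. \<integral>\<omega>. exp (- b * x * G (1/t) \<omega>) * sin (a * x * G (1/t) \<omega>) \<partial>M"
  have N: "?N \<ge> 2" and realN: "2 * real n + 1 = real ?N" using n by auto
  have ab: "a = Re (ray_direction ?N)" "b = Im (ray_direction ?N)"
    by (simp_all add: a b ray_direction_def add.commute)
  have D: "distributed M lborel (G (1 / t)) (\<lambda>x. ennreal (gen_gamma_density (real ?N) (1 / t) x))"
    if "t > 0" for t
    using G[of "1 / t"] that unfolding realN by simp
  note E = gen_gamma_expectation[OF N _ D, folded ab]
  have formula: "1 / (pi * x) * ?g t x = ?U x t" if "t > 0" "x \<noteq> 0" for t x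
    using E(2)[OF that(1) that(1), of x] that by simp
  \<comment> \<open>Off 0 the formula is the ray function, which is continuous at 0; by uniqueness
    of limits the condition at the origin fixes \<open>u 0 t\<close>.\<close>
  have limit: "((\<lambda>x. 1 / (pi * x) * ?g t x) \<longlongrightarrow> u 0 t) (at 0) \<longleftrightarrow> u 0 t = ?U 0 t" if t: "t > 0" for t
  proof -
    have "isCont (\<lambda>x. ?U x t) 0"
      using deriv_power_ray_solution(2)[OF N t, of 0] by (auto intro: DERIV_isCont)
    then have U: "((\<lambda>x. ?U x t) \<longlongrightarrow> ?U 0 t) (at 0)" by (simp add: isCont_def)
    have "((\<lambda>x. 1 / (pi * x) * ?g t x) \<longlongrightarrow> u 0 t) (at 0) \<longleftrightarrow> ((\<lambda>x. ?U x t) \<longlongrightarrow> u 0 t) (at 0)"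
    proof (rule filterlim_cong[OF refl refl])
      show "eventually (\<lambda>x. 1 / (pi * x) * ?g t x = ?U x t) (at 0)"
        unfolding eventually_at_filter by (intro always_eventually allI impI formula t)
    qed
    also have "\<dots> \<longleftrightarrow> u 0 t = ?U 0 t"
      using U tendsto_unique[OF at_neq_bot _ U, of "u 0 t"] by metis
    finally show ?thesis .
  qed
  have "(\<forall>t>0. (\<forall>x. x \<noteq> 0 \<longrightarrow> u x t = 1 / (pi * x) * ?g t x) \<and>
        ((\<lambda>x. 1 / (pi * x) * ?g t x) \<longlongrightarrow> u 0 t) (at 0)) \<longleftrightarrow>
      (\<forall>t>0. (\<forall>x. x \<noteq> 0 \<longrightarrow> u x t = ?U x t) \<and> u 0 t = ?U 0 t)"
    by (intro all_cong1 imp_cong conj_cong refl limit) (subst formula, assumption+, rule refl)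
  also have "\<dots> \<longleftrightarrow> (\<forall>t>0. \<forall>x. u x t = ?U x t)" by metis
  also have "\<dots> \<longleftrightarrow> fundamental_solution n u" by (rule fundamental_solution_iff[OF n, symmetric])
  finally show ?thesis using E(1) by blast
qed

end
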